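(* Let $(M,\langle\,,\,\rangle)$ be a complete non-compact Riemannian manifold and let $V$ be a smooth closed conformal vector field on $M$ with conformal factor $\phi\in C^\infty(M)$. If $\langle\nabla\phi,V\rangle\ge 0$ on $M$, then the energy function $f=\frac12\langle V,V\rangle$ is convex. If, in addition, the vector field $V$ and the function $\phi$ never vanish, then $f$ is strictly convex.
   Context: All manifolds, vector fields and functions are smooth. Let $D$ be the Levi-Civita connection of $M$ and $\nabla\phi$ the gradient of $\phi$. A vector field $V$ is conformal with conformal factor $\phi$ if $\mathcal{L}_V\langle\,,\,\rangle=2\phi\langle\,,\,\rangle$, where $\mathcal{L}$ is the Lie derivative; it is a closed conformal vector field with conformal factor $\phi$ if $D_XV=\phi X$ for every vector field $X$ on $M$. A function $f:M\to\mathbb{R}$ is convex if for every geodesic segment $\gamma:[a,b]\to M$ and every $t\in[0,1]$, $f(\gamma((1-t)a+tb))\le(1-t)f(\gamma(a))+tf(\gamma(b))$; it is strictly convex if this inequality is strict for every $t\in(0,1)$ and every non-constant geodesic segment with $a<b$. Geodesics here are all solutions of the geodesic equation, not only minimizing ones. *)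

theory Defs
  imports "HOL-Analysis.Analysis" "HOL-Library.Function_Algebras"
begin

section \<open>Smooth maps between Euclidean spaces\<close>

text \<open>Meant for open \<open>S\<close> in a finite-dimensional space, where a map is of class $C^{k+1}$ iff it is
  differentiable and all its directional derivatives are of class $C^k$.\<close>

primrec Ck_on :: "nat \<Rightarrow> 'a::euclidean_space set \<Rightarrow> ('a \<Rightarrow> 'b::real_normed_vector) \<Rightarrow> bool" where
  "Ck_on 0 S f \<longleftrightarrow> continuous_on S f"
| "Ck_on (Suc k) S f \<longleftrightarrow>
     (\<forall>x\<in>S. f differentiable (at x)) \<and> (\<forall>u. Ck_on k S (\<lambda>x. frechet_derivative f (at x) u))"

definition smooth_on :: "'a::euclidean_space set \<Rightarrow> ('a \<Rightarrow> 'b::real_normed_vector) \<Rightarrow> bool" where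
  "smooth_on S f \<longleftrightarrow> (\<forall>k. Ck_on k S f)"


section \<open>Smooth manifolds\<close>

text \<open>The manifold is the whole Hausdorff, second countable space \<open>'m\<close>, modelled on the Euclidean
  space \<open>'e\<close>. A chart is a pair \<open>(U, \<psi>)\<close>; the values of \<open>\<psi>\<close> outside \<open>U\<close> are irrelevant.\<close>

type_synonym ('m, 'e) chart = "'m set \<times> ('m \<Rightarrow> 'e)"

definition chart_inv :: "('m, 'e) chart \<Rightarrow> 'e \<Rightarrow> 'm" where
  "chart_inv c = inv_into (fst c) (snd c)"

definition smooth_atlas ::
  "('m::{t2_space,second_countable_topology}, 'e::euclidean_space) chart set \<Rightarrow> bool" where
  "smooth_atlas A \<longleftrightarrow>
     (\<Union>c\<in>A. fst c) = UNIV \<and>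
     (\<forall>c\<in>A. open (fst c) \<and> open (snd c ` fst c) \<and>
        homeomorphism (fst c) (snd c ` fst c) (snd c) (chart_inv c)) \<and>
     (\<forall>c\<in>A. \<forall>d\<in>A. smooth_on (snd c ` (fst c \<inter> fst d)) (snd d \<circ> chart_inv c))"

definition smooth_fun ::
  "('m, 'e::euclidean_space) chart set \<Rightarrow> 'm set \<Rightarrow> ('m \<Rightarrow> real) \<Rightarrow> bool" where
  "smooth_fun A W f \<longleftrightarrow> (\<forall>c\<in>A. smooth_on (snd c ` (fst c \<inter> W)) (f \<circ> chart_inv c))"


section \<open>Tangent vectors and vector fields\<close>

text \<open>A tangent vector at \<open>p\<close> is the family of its components in all charts around \<open>p\<close>, related by
  the differentials of the chart transitions. Components in all other index positions are set to 0,
  so that equality of families is equality of tangent vectors. Addition and zero are pointwise.\<close>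

type_synonym ('m, 'e) tvec = "('m, 'e) chart \<Rightarrow> 'e"

definition tscale :: "real \<Rightarrow> ('m, 'e::euclidean_space) tvec \<Rightarrow> ('m, 'e) tvec" where
  "tscale a v = (\<lambda>c. a *\<^sub>R v c)"

definition tangent_space ::
  "('m, 'e::euclidean_space) chart set \<Rightarrow> 'm \<Rightarrow> ('m, 'e) tvec set" where
  "tangent_space A p = {v.
     (\<forall>c. \<not> (c \<in> A \<and> p \<in> fst c) \<longrightarrow> v c = 0) \<and>
     (\<forall>c\<in>A. \<forall>d\<in>A. p \<in> fst c \<and> p \<in> fst d \<longrightarrow>
        v d = frechet_derivative (snd d \<circ> chart_inv c) (at (snd c p)) (v c))}"

text \<open>The tangent vector at \<open>p\<close> whose component in the chart \<open>c\<close> around \<open>p\<close> is \<open>u\<close>. For fixed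
  \<open>c\<close> and \<open>u\<close> in the standard basis this is a coordinate vector field of \<open>c\<close>.\<close>

definition coord_vec ::
  "('m, 'e::euclidean_space) chart set \<Rightarrow> ('m, 'e) chart \<Rightarrow> 'e \<Rightarrow> 'm \<Rightarrow> ('m, 'e) tvec" where
  "coord_vec A c u p = (\<lambda>d. if d \<in> A \<and> p \<in> fst d
     then frechet_derivative (snd d \<circ> chart_inv c) (at (snd c p)) u else 0)"

definition smooth_field ::
  "('m, 'e::euclidean_space) chart set \<Rightarrow> 'm set \<Rightarrow> ('m \<Rightarrow> ('m, 'e) tvec) \<Rightarrow> bool" where
  "smooth_field A W X \<longleftrightarrow>
     (\<forall>p\<in>W. X p \<in> tangent_space A p) \<and>
     (\<forall>c\<in>A. smooth_on (snd c ` (fst c \<inter> W)) (\<lambda>x. X (chart_inv c x) c))"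

text \<open>The derivative \<open>v f\<close> of a function \<open>f\<close>, smooth near \<open>p\<close>, along a tangent vector \<open>v\<close> at \<open>p\<close>;
  by the chain rule the choice of the chart around \<open>p\<close> does not matter.\<close>

definition tderiv ::
  "('m, 'e::euclidean_space) chart set \<Rightarrow> 'm \<Rightarrow> ('m, 'e) tvec \<Rightarrow> ('m \<Rightarrow> real) \<Rightarrow> real" where
  "tderiv A p v f = (let c = (SOME c. c \<in> A \<and> p \<in> fst c) in
     frechet_derivative (f \<circ> chart_inv c) (at (snd c p)) (v c))"

text \<open>In coordinates, $[X,Y] = dY(X) - dX(Y)$.\<close>

definition lie_bracket ::
  "('m, 'e::euclidean_space) chart set \<Rightarrow> ('m \<Rightarrow> ('m, 'e) tvec) \<Rightarrow> ('m \<Rightarrow> ('m, 'e) tvec) \<Rightarrow>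
   'm \<Rightarrow> ('m, 'e) tvec" where
  "lie_bracket A X Y p = (\<lambda>c. if c \<in> A \<and> p \<in> fst c
     then frechet_derivative (\<lambda>x. Y (chart_inv c x) c) (at (snd c p)) (X p c)
        - frechet_derivative (\<lambda>x. X (chart_inv c x) c) (at (snd c p)) (Y p c)
     else 0)"


section \<open>Riemannian metrics\<close>

type_synonym ('m, 'e) metric = "'m \<Rightarrow> ('m, 'e) tvec \<Rightarrow> ('m, 'e) tvec \<Rightarrow> real"

definition riemannian_metric ::
  "('m, 'e::euclidean_space) chart set \<Rightarrow> ('m, 'e) metric \<Rightarrow> bool" where
  "riemannian_metric A g \<longleftrightarrow>
     (\<forall>p. \<forall>u\<in>tangent_space A p. \<forall>v\<in>tangent_space A p. \<forall>w\<in>tangent_space A p. \<forall>a.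
        g p u v = g p v u \<and>
        g p (u + v) w = g p u w + g p v w \<and>
        g p (tscale a u) v = a * g p u v \<and>
        (u \<noteq> 0 \<longrightarrow> g p u u > 0)) \<and>
     (\<forall>c\<in>A. \<forall>u w. smooth_fun A (fst c) (\<lambda>p. g p (coord_vec A c u p) (coord_vec A c w p)))"

definition riemannian_manifold ::
  "('m::{t2_space,second_countable_topology}, 'e::euclidean_space) chart set \<Rightarrow>
   ('m, 'e) metric \<Rightarrow> bool" where
  "riemannian_manifold A g \<longleftrightarrow> smooth_atlas A \<and> riemannian_metric A g"

definition gradient ::
  "('m, 'e::euclidean_space) chart set \<Rightarrow> ('m, 'e) metric \<Rightarrow> ('m \<Rightarrow> real) \<Rightarrow>
   'm \<Rightarrow> ('m, 'e) tvec" where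
  "gradient A g f p = (THE w. w \<in> tangent_space A p \<and>
     (\<forall>v\<in>tangent_space A p. g p w v = tderiv A p v f))"


section \<open>The Levi-Civita connection\<close>

text \<open>\<open>D p v Y\<close> is the covariant derivative at \<open>p\<close> of the field \<open>Y\<close> in the direction of the tangent
  vector \<open>v\<close> at \<open>p\<close>; thus $(D_X Y)(p)$ is \<open>D p (X p) Y\<close>. As usual the axioms are imposed
  for vector fields \<open>Y\<close> and functions \<open>f\<close> that are smooth on some open neighbourhood \<open>W\<close> of \<open>p\<close>.
  Locality is then a consequence of the Leibniz rule, applied to a function \<open>f\<close> that is 1 on a
  neighbourhood of \<open>p\<close> and 0 elsewhere.\<close>

type_synonym ('m, 'e) conn = "'m \<Rightarrow> ('m, 'e) tvec \<Rightarrow> ('m \<Rightarrow> ('m, 'e) tvec) \<Rightarrow> ('m, 'e) tvec"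

definition affine_connection ::
  "('m::topological_space, 'e::euclidean_space) chart set \<Rightarrow> ('m, 'e) conn \<Rightarrow> bool" where
  "affine_connection A D \<longleftrightarrow>
     (\<forall>W. open W \<longrightarrow>
        (\<forall>X Y. smooth_field A W X \<and> smooth_field A W Y \<longrightarrow>
           smooth_field A W (\<lambda>p. D p (X p) Y)) \<and>
        (\<forall>p\<in>W. \<forall>Y. smooth_field A W Y \<longrightarrow>
           (\<forall>v\<in>tangent_space A p.
              D p v Y \<in> tangent_space A p \<and>
              (\<forall>w\<in>tangent_space A p. D p (v + w) Y = D p v Y + D p w Y) \<and>
              (\<forall>a. D p (tscale a v) Y = tscale a (D p v Y)) \<and>
              (\<forall>Z. smooth_field A W Z \<longrightarrow> D p v (\<lambda>q. Y q + Z q) = D p v Y + D p v Z) \<and>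
              (\<forall>f. smooth_fun A W f \<longrightarrow>
                 D p v (\<lambda>q. tscale (f q) (Y q)) =
                 tscale (tderiv A p v f) (Y p) + tscale (f p) (D p v Y)))))"

definition levi_civita ::
  "('m::topological_space, 'e::euclidean_space) chart set \<Rightarrow> ('m, 'e) metric \<Rightarrow>
   ('m, 'e) conn \<Rightarrow> bool" where
  "levi_civita A g D \<longleftrightarrow>
     affine_connection A D \<and>
     (\<forall>W X Y. open W \<and> smooth_field A W X \<and> smooth_field A W Y \<longrightarrow>
        (\<forall>p\<in>W.
           D p (X p) Y - D p (Y p) X = lie_bracket A X Y p \<and>
           (\<forall>v\<in>tangent_space A p.
              tderiv A p v (\<lambda>q. g q (X q) (Y q)) = g p (D p v X) (Y p) + g p (X p) (D p v Y))))"

text \<open>The component in the chart \<open>c\<close> of the derivative in direction \<open>u\<close> of the field with constant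
  component \<open>w\<close>, so $\Gamma(u,w)^k = \sum_{i,j} \Gamma_{ij}^k u^i w^j$.\<close>

definition christoffel ::
  "('m, 'e::euclidean_space) chart set \<Rightarrow> ('m, 'e) conn \<Rightarrow> ('m, 'e) chart \<Rightarrow> 'm \<Rightarrow>
   'e \<Rightarrow> 'e \<Rightarrow> 'e" where
  "christoffel A D c p u w = D p (coord_vec A c u p) (coord_vec A c w) c"


section \<open>Geodesics and completeness\<close>

text \<open>In every chart the curve satisfies $x'' + \Gamma(x',x') = 0$; the function \<open>x'\<close> is the
  coordinate velocity. Derivatives are one-sided at endpoints of \<open>I\<close> belonging to \<open>I\<close>. Since the
  Christoffel symbols are smooth, such curves are automatically smooth.\<close>

definition geodesic_on ::
  "('m::topological_space, 'e::euclidean_space) chart set \<Rightarrow> ('m, 'e) conn \<Rightarrow> real set \<Rightarrow>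
   (real \<Rightarrow> 'm) \<Rightarrow> bool" where
  "geodesic_on A D I \<gamma> \<longleftrightarrow>
     continuous_on I \<gamma> \<and>
     (\<forall>c\<in>A. let J = {t\<in>I. \<gamma> t \<in> fst c} in
        \<exists>x'. \<forall>t\<in>J.
          ((snd c \<circ> \<gamma>) has_vector_derivative x' t) (at t within J) \<and>
          (x' has_vector_derivative - christoffel A D c (\<gamma> t) (x' t) (x' t)) (at t within J))"

text \<open>Geodesic completeness: the exponential map is defined on the whole tangent bundle.\<close>

definition complete_manifold ::
  "('m::topological_space, 'e::euclidean_space) chart set \<Rightarrow> ('m, 'e) conn \<Rightarrow> bool" where
  "complete_manifold A D \<longleftrightarrow>
     (\<forall>p. \<forall>v\<in>tangent_space A p. \<exists>\<gamma>. geodesic_on A D UNIV \<gamma> \<and> \<gamma> 0 = p \<and>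
        (\<forall>c\<in>A. p \<in> fst c \<longrightarrow> ((snd c \<circ> \<gamma>) has_vector_derivative v c) (at 0)))"


section \<open>Convex functions and closed conformal vector fields\<close>

definition geod_convex ::
  "('m::topological_space, 'e::euclidean_space) chart set \<Rightarrow> ('m, 'e) conn \<Rightarrow>
   ('m \<Rightarrow> real) \<Rightarrow> bool" where
  "geod_convex A D f \<longleftrightarrow>
     (\<forall>a b \<gamma>. a \<le> b \<and> geodesic_on A D {a..b} \<gamma> \<longrightarrow>
        (\<forall>t\<in>{0..1}. f (\<gamma> ((1 - t) * a + t * b)) \<le> (1 - t) * f (\<gamma> a) + t * f (\<gamma> b)))"

definition geod_strictly_convex ::
  "('m::topological_space, 'e::euclidean_space) chart set \<Rightarrow> ('m, 'e) conn \<Rightarrow>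
   ('m \<Rightarrow> real) \<Rightarrow> bool" where
  "geod_strictly_convex A D f \<longleftrightarrow>
     (\<forall>a b \<gamma>. a < b \<and> geodesic_on A D {a..b} \<gamma> \<and> \<not> \<gamma> constant_on {a..b} \<longrightarrow>
        (\<forall>t\<in>{0<..<1}. f (\<gamma> ((1 - t) * a + t * b)) < (1 - t) * f (\<gamma> a) + t * f (\<gamma> b)))"

text \<open>$D_X V = \phi X$ for all \<open>X\<close>. As $D_X V$ at \<open>p\<close> depends on \<open>X\<close> only through the tangent vector
  \<open>X p\<close>, which is arbitrary, the condition is stated for all tangent vectors.\<close>

definition closed_conformal ::
  "('m, 'e::euclidean_space) chart set \<Rightarrow> ('m, 'e) conn \<Rightarrow> ('m \<Rightarrow> ('m, 'e) tvec) \<Rightarrow>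
   ('m \<Rightarrow> real) \<Rightarrow> bool" where
  "closed_conformal A D V \<phi> \<longleftrightarrow> (\<forall>p. \<forall>v\<in>tangent_space A p. D p v V = tscale (\<phi> p) v)"

definition energy :: "('m, 'e) metric \<Rightarrow> ('m \<Rightarrow> ('m, 'e) tvec) \<Rightarrow> 'm \<Rightarrow> real" where
  "energy g V p = 1 / 2 * g p (V p) (V p)"

end

theory Submission
  imports Defs
begin

text \<open>Let \<open>\<omega> = \<langle>V, \<sqdot>\<rangle>\<close>. Then \<open>df = \<phi> \<omega>\<close>, and \<open>\<omega>\<close> is closed because \<open>D V = \<phi> Id\<close> is symmetric, so
  \<open>0 = d(df) = d\<phi> \<and> \<omega>\<close>. Inserting \<open>V\<close> gives
  \<open>(v\<phi>) \<langle>V, v\<rangle> \<langle>V, V\<rangle> = \<langle>\<nabla>\<phi>, V\<rangle> \<langle>V, v\<rangle>\<^sup>2 \<ge> 0\<close> for every tangent vector \<open>v\<close>. Along a geodesic \<open>\<gamma>\<close>,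
  \<open>(f \<circ> \<gamma>)'' = (\<gamma>'\<phi>) \<langle>V, \<gamma>'\<rangle> + \<phi>\<^sup>2 \<langle>\<gamma>', \<gamma>'\<rangle>\<close> is therefore non-negative. If \<open>\<phi>\<close> never
  vanishes and \<open>\<gamma>\<close> is not constant, it is positive, since \<open>\<langle>\<gamma>', \<gamma>'\<rangle>\<close> is constant.\<close>

section \<open>Calculus of smooth maps\<close>

text \<open>The velocity of a geodesic is a vector only along the curve, while the axioms of
  \<open>D\<close> speak of fields on open sets. So \<gamma>' is expanded in the coordinate fields
  of a chart. The product rule then yields derivatives of the components, known from the geodesic
  equation, and covariant derivatives of coordinate fields; the Christoffel terms cancel. Constant
  speed follows in the same way and does the work of uniqueness of geodesics: one zero of the
  velocity makes it vanish throughout. The identity d(df) = 0 becomes the symmetry of the second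
  derivatives of \<langle>V, V\<rangle> in a chart, and closedness of \<omega> becomes the symmetry
  of the metric and of \<open>D\<close> on coordinate fields. The second derivative along \<gamma>
  is one-sided at the ends and comes without a continuity statement, so convexity is read off from
  mean values: the gap between chord and graph is a positive multiple of (f \<circ> \<gamma>)'' at a
  single point.\<close>

lemma frechet_derivative_cong_open:
  assumes "open S" "x \<in> S" "\<And>y. y \<in> S \<Longrightarrow> f y = g y"
  shows "frechet_derivative f (at x) = frechet_derivative g (at x)"
proof -
  \<comment> \<open>\<open>frechet_derivative\<close> is a choice operator; both choices are made
    from the same predicate, so the equality also covers points where no derivative exists.\<close>
  have "(f has_derivative F) (at x) \<longleftrightarrow> (g has_derivative F) (at x)" for F
    using has_derivative_transform_within_open[of f F x UNIV S g]
      has_derivative_transform_within_open[of g F x UNIV S f] assms by auto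
  then show ?thesis
    by (simp add: frechet_derivative_def)
qed

lemma has_derivative_imp_frechet: "(f has_derivative F) (at x) \<Longrightarrow> frechet_derivative f (at x) = F"
  using frechet_derivative_at by metis

lemma differentiable_has_frechet:
  "f differentiable at x \<Longrightarrow> (f has_derivative frechet_derivative f (at x)) (at x)"
  using frechet_derivative_works by blast

lemma differentiable_cong_open:
  assumes "open S" "x \<in> S" "\<And>y. y \<in> S \<Longrightarrow> f y = g y" "f differentiable at x"
  shows "g differentiable at x"
  using assms has_derivative_transform_within_open[of f _ x UNIV S g]
  unfolding differentiable_def by blast

text \<open>Product and chain rules give formulas for derivatives at points of \<open>S\<close>
  only; this is how they are carried through the recursion of \<open>Ck_on\<close>. Openness of
  \<open>S\<close> makes the derivatives agree along with the functions.\<close>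

lemma Ck_on_cong:
  assumes "open S" "\<And>x. x \<in> S \<Longrightarrow> f x = g x" "Ck_on k S f"
  shows "Ck_on k S g"
  using assms
proof (induction k arbitrary: f g)
  case 0
  then show ?case by (metis Ck_on.simps(1) continuous_on_cong)
next
  case (Suc k)
  have "g differentiable at x" if "x \<in> S" for x
    using Suc.prems that differentiable_cong_open[of S x f g] by auto
  moreover have "Ck_on k S (\<lambda>x. frechet_derivative g (at x) u)" for u
  proof (rule Suc.IH)
    show "frechet_derivative f (at x) u = frechet_derivative g (at x) u" if "x \<in> S" for x
      using frechet_derivative_cong_open[of S x f g] Suc.prems that by simp
  qed (use Suc.prems in auto)
  ultimately show ?case by simp
qed

lemma Ck_on_subset: "Ck_on k S f \<Longrightarrow> T \<subseteq> S \<Longrightarrow> Ck_on k T f"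
  by (induction k arbitrary: f) (auto intro: continuous_on_subset)

lemma Ck_on_Suc_imp: "Ck_on (Suc k) S f \<Longrightarrow> Ck_on k S f"
proof (induction k arbitrary: f)
  case 0
  then show ?case
    by (simp add: differentiable_imp_continuous_on differentiable_at_imp_differentiable_on)
next
  case (Suc k)
  have "f differentiable at x" if "x \<in> S" for x
    using Suc.prems that by simp
  moreover have "Ck_on k S (\<lambda>x. frechet_derivative f (at x) u)" for u
    using Suc.prems by (intro Suc.IH) simp
  ultimately show ?case by simp
qed

lemma Ck_on_const: "Ck_on k S (\<lambda>x. c)"
  by (induction k arbitrary: c) auto

lemma Ck_on_add:
  assumes "open S" "Ck_on k S f" "Ck_on k S g"
  shows "Ck_on k S (\<lambda>x. f x + g x)"
  using assms(2,3)
proof (induction k arbitrary: f g)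
  case 0
  then show ?case by (simp add: continuous_on_add)
next
  case (Suc k)
  have "Ck_on k S (\<lambda>x. frechet_derivative (\<lambda>x. f x + g x) (at x) u)" for u
  proof (rule Ck_on_cong[OF \<open>open S\<close>])
    show "Ck_on k S (\<lambda>x. frechet_derivative f (at x) u + frechet_derivative g (at x) u)"
      using Suc by simp
    show "frechet_derivative f (at x) u + frechet_derivative g (at x) u
        = frechet_derivative (\<lambda>x. f x + g x) (at x) u" if "x \<in> S" for x
      using Suc.prems that
      by (subst has_derivative_imp_frechet[OF has_derivative_add[OF differentiable_has_frechet
              differentiable_has_frechet]]) auto
  qed
  then show ?case using Suc.prems by simp
qed

lemma Ck_on_sum:
  assumes "open S" "finite I" "\<And>i. i \<in> I \<Longrightarrow> Ck_on k S (f i)"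
  shows "Ck_on k S (\<lambda>x. \<Sum>i\<in>I. f i x)"
  using assms(2,3) by (induction I rule: finite_induct) (simp_all add: Ck_on_const Ck_on_add[OF \<open>open S\<close>])

lemma Ck_on_scaleR:
  assumes "open S" "Ck_on k S f" "Ck_on k S g"
  shows "Ck_on k S (\<lambda>x. f x *\<^sub>R g x)"
  using assms(2,3)
proof (induction k arbitrary: f g)
  case 0
  then show ?case by (simp add: continuous_on_scaleR)
next
  case (Suc k)
  have "Ck_on k S (\<lambda>x. frechet_derivative (\<lambda>x. f x *\<^sub>R g x) (at x) u)" for u
  proof (rule Ck_on_cong[OF \<open>open S\<close>])
    \<comment> \<open>The factors left undifferentiated by the product rule enter at order
      \<open>k\<close>, one less than they have.\<close>
    show "Ck_on k S (\<lambda>x. f x *\<^sub>R frechet_derivative g (at x) u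
        + frechet_derivative f (at x) u *\<^sub>R g x)"
      using Suc.prems
      by (intro Ck_on_add[OF \<open>open S\<close>] Suc.IH Ck_on_Suc_imp[of k S f] Ck_on_Suc_imp[of k S g]) auto
    show "f x *\<^sub>R frechet_derivative g (at x) u + frechet_derivative f (at x) u *\<^sub>R g x
        = frechet_derivative (\<lambda>x. f x *\<^sub>R g x) (at x) u" if "x \<in> S" for x
      using Suc.prems that
      by (subst has_derivative_imp_frechet[OF has_derivative_scaleR[OF differentiable_has_frechet
              differentiable_has_frechet]]) auto
  qed
  then show ?case using Suc.prems by simp
qed

lemma Ck_on_inner_const:
  assumes "open S" "Ck_on k S f"
  shows "Ck_on k S (\<lambda>x. f x \<bullet> b)"
  using assms(2)
proof (induction k arbitrary: f)
  case 0
  then show ?case by (simp add: continuous_on_inner)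
next
  case (Suc k)
  have D: "((\<lambda>x. f x \<bullet> b) has_derivative (\<lambda>u. frechet_derivative f (at x) u \<bullet> b)) (at x)"
    if "x \<in> S" for x
    using Suc.prems that by (intro has_derivative_inner_left differentiable_has_frechet) auto
  have "Ck_on k S (\<lambda>x. frechet_derivative (\<lambda>x. f x \<bullet> b) (at x) u)" for u
  proof (rule Ck_on_cong[OF \<open>open S\<close>])
    show "Ck_on k S (\<lambda>x. frechet_derivative f (at x) u \<bullet> b)"
      using Suc by simp
  qed (simp add: has_derivative_imp_frechet[OF D])
  then show ?case using D by (auto simp: differentiable_def)
qed

lemma linear_sum_Basis:
  fixes f :: "'a::euclidean_space \<Rightarrow> 'b::real_vector"
  assumes "linear f"
  shows "f u = (\<Sum>b\<in>Basis. (u \<bullet> b) *\<^sub>R f b)"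
proof -
  have "f u = f (\<Sum>b\<in>Basis. (u \<bullet> b) *\<^sub>R b)" by (simp add: euclidean_representation)
  then show ?thesis using assms by (simp add: linear_sum linear_scale)
qed

text \<open>In the chain rule the outer derivative is taken in a direction that varies with the
  point, whereas \<open>Ck_on\<close> controls fixed directions. Expanding that direction in
  \<open>Basis\<close> leaves products of components of the derivative of \<open>h\<close> with
  fixed-direction derivatives of \<open>f\<close> composed with \<open>h\<close>, to which the
  induction hypothesis applies.\<close>

lemma Ck_on_compose:
  fixes f :: "'b::euclidean_space \<Rightarrow> 'c::real_normed_vector" and h :: "'a::euclidean_space \<Rightarrow> 'b"
  assumes "open S" "open T" "h ` S \<subseteq> T" "Ck_on k T f" "Ck_on k S h"
  shows "Ck_on k S (f \<circ> h)"
  using assms(4,5)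
proof (induction k arbitrary: f)
  case 0
  then show ?case
    using \<open>h ` S \<subseteq> T\<close> unfolding Ck_on.simps
    by (blast intro: continuous_on_compose continuous_on_subset)
next
  case (Suc k)
  have fT: "f differentiable at (h x)" if "x \<in> S" for x
    using Suc.prems \<open>h ` S \<subseteq> T\<close> that by auto
  have D: "(f \<circ> h has_derivative
      (frechet_derivative f (at (h x)) \<circ> frechet_derivative h (at x))) (at x)" if "x \<in> S" for x
    using Suc.prems fT that by (intro diff_chain_at differentiable_has_frechet) auto
  have "Ck_on k S (\<lambda>x. frechet_derivative (f \<circ> h) (at x) u)" for u
  proof (rule Ck_on_cong[OF \<open>open S\<close>])
    show "Ck_on k S (\<lambda>x. \<Sum>b\<in>Basis. (frechet_derivative h (at x) u \<bullet> b) *\<^sub>R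
        ((\<lambda>y. frechet_derivative f (at y) b) \<circ> h) x)"
      using Suc.prems
      by (intro Ck_on_sum Ck_on_scaleR Ck_on_inner_const Suc.IH \<open>open S\<close> Ck_on_Suc_imp[of k S h])
        auto
    show "(\<Sum>b\<in>Basis. (frechet_derivative h (at x) u \<bullet> b) *\<^sub>R
        ((\<lambda>y. frechet_derivative f (at y) b) \<circ> h) x) = frechet_derivative (f \<circ> h) (at x) u"
      if "x \<in> S" for x
      using linear_sum_Basis[OF linear_frechet_derivative[OF fT[OF that]], of "frechet_derivative h (at x) u"]
      by (simp add: has_derivative_imp_frechet[OF D[OF that]])
  qed
  moreover have "(f \<circ> h) differentiable at x" if "x \<in> S" for x
    using D[OF that] differentiable_def by blast
  ultimately show ?case unfolding Ck_on.simps by blast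
qed

lemma smooth_on_differentiable: "smooth_on S f \<Longrightarrow> x \<in> S \<Longrightarrow> f differentiable at x"
  unfolding smooth_on_def by (drule spec[of _ "Suc 0"]) simp

lemma smooth_on_cong:
  "open S \<Longrightarrow> (\<And>x. x \<in> S \<Longrightarrow> f x = g x) \<Longrightarrow> smooth_on S f \<Longrightarrow> smooth_on S g"
  using Ck_on_cong[of S f g] by (simp add: smooth_on_def)

lemma smooth_on_subset: "smooth_on S f \<Longrightarrow> T \<subseteq> S \<Longrightarrow> smooth_on T f"
  by (auto simp: smooth_on_def intro: Ck_on_subset)

lemma smooth_on_frechet: "smooth_on S f \<Longrightarrow> smooth_on S (\<lambda>x. frechet_derivative f (at x) u)"
proof (unfold smooth_on_def, rule allI)
  fix k assume "\<forall>k. Ck_on k S f"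
  from spec[OF this, of "Suc k"] show "Ck_on k S (\<lambda>x. frechet_derivative f (at x) u)"
    by simp
qed

lemma smooth_on_compose:
  fixes f :: "'b::euclidean_space \<Rightarrow> 'c::real_normed_vector" and h :: "'a::euclidean_space \<Rightarrow> 'b"
  assumes "open S" "open T" "h ` S \<subseteq> T" "smooth_on T f" "smooth_on S h"
  shows "smooth_on S (f \<circ> h)"
  using assms Ck_on_compose unfolding smooth_on_def by blast

lemma smooth_on_linear_combination:
  fixes f :: "'a::euclidean_space \<Rightarrow> 'b::euclidean_space"
  assumes "open S" "smooth_on S f" "\<And>b. b \<in> Basis \<Longrightarrow> smooth_on S (h b)"
  shows "smooth_on S (\<lambda>x. \<Sum>b\<in>Basis. (f x \<bullet> b) * h b x)"
proof (unfold smooth_on_def, rule allI)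
  fix k
  have "Ck_on k S (\<lambda>x. \<Sum>b\<in>Basis. (f x \<bullet> b) *\<^sub>R h b x)"
    using assms(2,3)
    by (intro Ck_on_sum Ck_on_scaleR Ck_on_inner_const \<open>open S\<close>) (auto simp: smooth_on_def)
  then show "Ck_on k S (\<lambda>x. \<Sum>b\<in>Basis. (f x \<bullet> b) * h b x)" by simp
qed

text \<open>Two applications of the mean value theorem, first along \<open>u\<close> and then along
  \<open>w\<close>, turn the second difference over a parallelogram into \<open>h * h\<close> times
  \<open>Q\<close> at a point inside it; continuity of \<open>Q\<close> gives the limit.\<close>

lemma mixed_difference_tendsto:
  fixes F :: "'a::euclidean_space \<Rightarrow> real" and u w :: 'a
  assumes "open S" "x \<in> S" "smooth_on S F"
  defines "Q \<equiv> \<lambda>y. frechet_derivative (\<lambda>z. frechet_derivative F (at z) u) (at y) w"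
  shows "((\<lambda>h. (F (x + h *\<^sub>R u + h *\<^sub>R w) - F (x + h *\<^sub>R u) - F (x + h *\<^sub>R w) + F x) / (h * h))
    \<longlongrightarrow> Q x) (at_right 0)"
proof (rule tendstoI)
  fix e :: real assume "e > 0"
  let ?P = "\<lambda>z. frechet_derivative F (at z) u"
  have smP: "smooth_on S ?P" using smooth_on_frechet assms(3) .
  have "smooth_on S Q" unfolding Q_def by (intro smooth_on_frechet smP)
  then have "continuous_on S Q" unfolding smooth_on_def by (drule_tac spec[of _ 0]) simp
  then have "isCont Q x" using assms(1,2) by (simp add: continuous_on_eq_continuous_at)
  then obtain d1 where d1: "d1 > 0" "\<And>y. dist y x < d1 \<Longrightarrow> dist (Q y) (Q x) < e"
    using \<open>e > 0\<close> unfolding continuous_at_eps_delta by blast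
  obtain d2 where d2: "d2 > 0" "ball x d2 \<subseteq> S"
    using assms(1,2) openE by blast
  define d where "d = min d1 d2"
  \<comment> \<open>For \<open>h < h0\<close> the parallelogram with sides
    \<open>h *\<^sub>R u\<close> and \<open>h *\<^sub>R w\<close> stays in the ball of radius
    \<open>d\<close>. The summand 1 keeps the denominator positive when \<open>u\<close> and
    \<open>w\<close> are both 0.\<close>
  define h0 where "h0 = d / (norm u + norm w + 1)"
  have pos: "norm u + norm w + 1 > 0" by (smt (verit) norm_ge_zero)
  have h0: "h0 > 0" using d1 d2 pos by (simp add: h0_def d_def)
  have near: "dist (x + s *\<^sub>R u + t *\<^sub>R w) x < d" if "0 \<le> s" "s \<le> h" "0 \<le> t" "t \<le> h" "h < h0"
    for s t h
  proof -
    have "dist (x + s *\<^sub>R u + t *\<^sub>R w) x = norm (s *\<^sub>R u + t *\<^sub>R w)"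
      by (simp add: dist_norm algebra_simps)
    also have "\<dots> \<le> s * norm u + t * norm w"
      using that norm_triangle_ineq[of "s *\<^sub>R u" "t *\<^sub>R w"] by simp
    also have "\<dots> \<le> h * norm u + h * norm w"
      using that by (intro add_mono mult_right_mono) auto
    also have "\<dots> \<le> h * (norm u + norm w + 1)"
      using that by (simp add: algebra_simps)
    also have "\<dots> < h0 * (norm u + norm w + 1)"
      using that pos by simp
    also have "\<dots> = d" using pos by (simp add: h0_def)
    finally show ?thesis .
  qed
  have inS: "x + s *\<^sub>R u + t *\<^sub>R w \<in> S" if "0 \<le> s" "s \<le> h" "0 \<le> t" "t \<le> h" "h < h0" for s t h
    using near[OF that] d2 by (auto simp: d_def dist_commute)
  have lineD: "((\<lambda>s. f (a + s *\<^sub>R v)) has_real_derivative frechet_derivative f (at (a + s *\<^sub>R v)) v) (at s)"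
    if "smooth_on S f" "a + s *\<^sub>R v \<in> S" for f :: "'a \<Rightarrow> real" and a v s
  proof -
    have D: "(f has_derivative frechet_derivative f (at (a + s *\<^sub>R v))) (at (a + s *\<^sub>R v))"
      using that differentiable_has_frechet smooth_on_differentiable by blast
    have "((\<lambda>s. a + s *\<^sub>R v) has_derivative (\<lambda>h. h *\<^sub>R v)) (at s)"
      by (auto intro!: derivative_eq_intros)
    from diff_chain_at[OF this D]
    have "(f \<circ> (\<lambda>s. a + s *\<^sub>R v) has_derivative frechet_derivative f (at (a + s *\<^sub>R v)) \<circ> (\<lambda>h. h *\<^sub>R v)) (at s)" .
    moreover have "frechet_derivative f (at (a + s *\<^sub>R v)) \<circ> (\<lambda>h. h *\<^sub>R v)
        = (*) (frechet_derivative f (at (a + s *\<^sub>R v)) v)"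
      using has_derivative_linear[OF D] by (simp add: linear_scale fun_eq_iff)
    ultimately show ?thesis by (simp add: has_field_derivative_def comp_def)
  qed
  have main: "dist ((F (x + h *\<^sub>R u + h *\<^sub>R w) - F (x + h *\<^sub>R u) - F (x + h *\<^sub>R w) + F x) / (h * h)) (Q x) < e"
    if h: "0 < h" "h < h0" for h
  proof -
    \<comment> \<open>The second difference is the increment of \<open>?G\<close> from 0 to
      \<open>h\<close>, so the first mean value step yields a difference of \<open>?P\<close> across
      \<open>h *\<^sub>R w\<close>.\<close>
    let ?G = "\<lambda>s. F ((x + h *\<^sub>R w) + s *\<^sub>R u) - F (x + s *\<^sub>R u)"
    have "\<exists>\<xi>>0. \<xi> < h \<and> ?G h - ?G 0 =
        (h - 0) * (?P ((x + h *\<^sub>R w) + \<xi> *\<^sub>R u) - ?P (x + \<xi> *\<^sub>R u))"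
    proof (rule MVT2[OF h(1)])
      fix s assume "0 \<le> s" "s \<le> h"
      then show "(?G has_real_derivative (?P ((x + h *\<^sub>R w) + s *\<^sub>R u) - ?P (x + s *\<^sub>R u))) (at s)"
        using inS[of s h 0] inS[of s h h] h
        by (intro DERIV_diff lineD assms) (auto simp: algebra_simps)
    qed
    then obtain \<xi> where \<xi>: "0 < \<xi>" "\<xi> < h"
      "?G h - ?G 0 = h * (?P (x + h *\<^sub>R w + \<xi> *\<^sub>R u) - ?P (x + \<xi> *\<^sub>R u))" by auto
    have "\<exists>\<eta>>0. \<eta> < h \<and> ?P ((x + \<xi> *\<^sub>R u) + h *\<^sub>R w) - ?P ((x + \<xi> *\<^sub>R u) + 0 *\<^sub>R w) =
        (h - 0) * Q ((x + \<xi> *\<^sub>R u) + \<eta> *\<^sub>R w)"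
    proof (rule MVT2[OF h(1)])
      fix s assume "0 \<le> s" "s \<le> h"
      then show "((\<lambda>s. ?P ((x + \<xi> *\<^sub>R u) + s *\<^sub>R w)) has_real_derivative Q ((x + \<xi> *\<^sub>R u) + s *\<^sub>R w)) (at s)"
        unfolding Q_def using inS[of \<xi> h s] h \<xi> by (intro lineD smP) auto
    qed
    then obtain \<eta> where \<eta>: "0 < \<eta>" "\<eta> < h"
      "?P (x + \<xi> *\<^sub>R u + h *\<^sub>R w) - ?P (x + \<xi> *\<^sub>R u) = h * Q (x + \<xi> *\<^sub>R u + \<eta> *\<^sub>R w)" by auto
    have "?G h - ?G 0 = h * (h * Q (x + \<xi> *\<^sub>R u + \<eta> *\<^sub>R w))"
      using \<xi>(3) \<eta>(3) by (simp add: add_ac)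
    moreover have "F (x + h *\<^sub>R u + h *\<^sub>R w) - F (x + h *\<^sub>R u) - F (x + h *\<^sub>R w) + F x = ?G h - ?G 0"
      by (simp add: add_ac)
    ultimately have "(F (x + h *\<^sub>R u + h *\<^sub>R w) - F (x + h *\<^sub>R u) - F (x + h *\<^sub>R w) + F x) / (h * h)
        = Q (x + \<xi> *\<^sub>R u + \<eta> *\<^sub>R w)" using h by (simp add: field_simps)
    moreover have "dist (x + \<xi> *\<^sub>R u + \<eta> *\<^sub>R w) x < d1"
      using near[of \<xi> h \<eta>] h \<xi> \<eta> by (simp add: d_def)
    ultimately show ?thesis using d1 by simp
  qed
  show "\<forall>\<^sub>F h in at_right 0. dist ((F (x + h *\<^sub>R u + h *\<^sub>R w) - F (x + h *\<^sub>R u) - F (x + h *\<^sub>R w) + F x) / (h * h)) (Q x) < e"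
    unfolding eventually_at_right_field using h0 main by blast
qed

text \<open>The second difference is unchanged when \<open>u\<close> and \<open>w\<close> are
  exchanged, so both iterated derivatives are limits of the same quotient.\<close>

lemma symmetric_second_derivative:
  fixes F :: "'a::euclidean_space \<Rightarrow> real"
  assumes "open S" "x \<in> S" "smooth_on S F"
  shows "frechet_derivative (\<lambda>z. frechet_derivative F (at z) u) (at x) w
       = frechet_derivative (\<lambda>z. frechet_derivative F (at z) w) (at x) u"
proof (rule tendsto_unique[OF _ mixed_difference_tendsto[OF assms]])
  have eq: "(\<lambda>h. (F (x + h *\<^sub>R u + h *\<^sub>R w) - F (x + h *\<^sub>R u) - F (x + h *\<^sub>R w) + F x) / (h * h))
    = (\<lambda>h. (F (x + h *\<^sub>R w + h *\<^sub>R u) - F (x + h *\<^sub>R w) - F (x + h *\<^sub>R u) + F x) / (h * h))"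
  proof
    fix h
    have e: "F (x + h *\<^sub>R u + h *\<^sub>R w) = F (x + h *\<^sub>R w + h *\<^sub>R u)"
      by (simp add: add_ac)
    show "(F (x + h *\<^sub>R u + h *\<^sub>R w) - F (x + h *\<^sub>R u) - F (x + h *\<^sub>R w) + F x) / (h * h)
      = (F (x + h *\<^sub>R w + h *\<^sub>R u) - F (x + h *\<^sub>R w) - F (x + h *\<^sub>R u) + F x) / (h * h)"
      unfolding e by simp
  qed
  show "((\<lambda>h. (F (x + h *\<^sub>R u + h *\<^sub>R w) - F (x + h *\<^sub>R u) - F (x + h *\<^sub>R w) + F x) / (h * h))
    \<longlongrightarrow> frechet_derivative (\<lambda>z. frechet_derivative F (at z) w) (at x) u) (at_right 0)"
    unfolding eq by (rule mixed_difference_tendsto[OF assms])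
qed simp

section \<open>Charts and tangent vectors\<close>

lemma tscale_apply: "tscale a v c = a *\<^sub>R v c"
  by (simp add: tscale_def)

locale smooth_mfd =
  fixes A :: "('m::{t2_space,second_countable_topology}, 'e::euclidean_space) chart set"
  assumes atlas: "smooth_atlas A"
begin

lemma ex_chart: obtains c where "c \<in> A" "p \<in> fst c"
  using atlas unfolding smooth_atlas_def by blast

lemma chart_homeo:
  "c \<in> A \<Longrightarrow> homeomorphism (fst c) (snd c ` fst c) (snd c) (chart_inv c)"
  using atlas unfolding smooth_atlas_def by blast

lemma open_chart: "c \<in> A \<Longrightarrow> open (fst c)"
  and open_chart_range: "c \<in> A \<Longrightarrow> open (snd c ` fst c)"
  using atlas unfolding smooth_atlas_def by blast+

lemma chart_inv_chart [simp]: "c \<in> A \<Longrightarrow> p \<in> fst c \<Longrightarrow> chart_inv c (snd c p) = p"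
  using chart_homeo homeomorphism_apply1 by blast

lemma open_chart_image:
  assumes "c \<in> A" "open W"
  shows "open (snd c ` (fst c \<inter> W))"
proof -
  have "snd c ` (fst c \<inter> W) = snd c ` fst c \<inter> chart_inv c -` W"
    using assms by auto
  moreover have "continuous_on (snd c ` fst c) (chart_inv c)"
    using chart_homeo[OF assms(1)] by (simp add: homeomorphism_def)
  ultimately show ?thesis
    using continuous_open_preimage open_chart_range assms by metis
qed

lemma smooth_transition:
  "c \<in> A \<Longrightarrow> d \<in> A \<Longrightarrow> smooth_on (snd c ` (fst c \<inter> fst d)) (snd d \<circ> chart_inv c)"
  using atlas unfolding smooth_atlas_def by blast

section \<open>Differentials of chart transitions\<close>

definition trans_deriv :: "('m, 'e) chart \<Rightarrow> ('m, 'e) chart \<Rightarrow> 'm \<Rightarrow> 'e \<Rightarrow> 'e" where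
  "trans_deriv c d p = frechet_derivative (snd d \<circ> chart_inv c) (at (snd c p))"

lemma has_derivative_transition:
  assumes "c \<in> A" "d \<in> A" "p \<in> fst c" "p \<in> fst d"
  shows "((snd d \<circ> chart_inv c) has_derivative trans_deriv c d p) (at (snd c p))"
  unfolding trans_deriv_def using assms
  by (intro differentiable_has_frechet smooth_on_differentiable[OF smooth_transition]) auto

lemma linear_trans_deriv:
  assumes "c \<in> A" "d \<in> A" "p \<in> fst c" "p \<in> fst d"
  shows "linear (trans_deriv c d p)"
  using has_derivative_transition[OF assms] has_derivative_linear by blast

text \<open>On the overlap, \<open>f\<close> read in \<open>c\<close> is \<open>f\<close> read in
  \<open>d\<close> after the transition map, so this is the chain rule. Applied to a chart map in
  place of \<open>f\<close> it becomes the cocycle rule.\<close>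

lemma has_derivative_change_chart:
  assumes "c \<in> A" "d \<in> A" "p \<in> fst c" "p \<in> fst d"
    and "((f \<circ> chart_inv d) has_derivative F) (at (snd d p))"
  shows "((f \<circ> chart_inv c) has_derivative F \<circ> trans_deriv c d p) (at (snd c p))"
proof (rule has_derivative_transform_within_open)
  have "(snd d \<circ> chart_inv c) (snd c p) = snd d p" using assms by simp
  then show "((f \<circ> chart_inv d) \<circ> (snd d \<circ> chart_inv c) has_derivative F \<circ> trans_deriv c d p)
      (at (snd c p))"
    using assms by (intro diff_chain_at has_derivative_transition) auto
  show "open (snd c ` (fst c \<inter> fst d))"
    using assms open_chart_image open_chart by blast
qed (use assms in auto)

lemma trans_deriv_cocycle:
  assumes "c \<in> A" "d \<in> A" "e \<in> A" "p \<in> fst c" "p \<in> fst d" "p \<in> fst e"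
  shows "trans_deriv d e p (trans_deriv c d p u) = trans_deriv c e p u"
proof -
  have "((snd e \<circ> chart_inv c) has_derivative trans_deriv d e p \<circ> trans_deriv c d p) (at (snd c p))"
    using assms by (intro has_derivative_change_chart has_derivative_transition) auto
  moreover have "((snd e \<circ> chart_inv c) has_derivative trans_deriv c e p) (at (snd c p))"
    using assms by (intro has_derivative_transition)
  ultimately show ?thesis
    using has_derivative_unique by (metis comp_apply)
qed

lemma trans_deriv_self:
  assumes "c \<in> A" "p \<in> fst c"
  shows "trans_deriv c c p u = u"
proof -
  have "((snd c \<circ> chart_inv c) has_derivative (\<lambda>u. u)) (at (snd c p))"
  proof (rule has_derivative_transform_within_open[OF has_derivative_ident])
    show "open (snd c ` fst c)" using assms open_chart_range by blast
  qed (use assms in auto)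
  then show ?thesis
    using has_derivative_transition[of c c p] assms has_derivative_unique by metis
qed

lemma coord_vec_apply:
  "d \<in> A \<Longrightarrow> p \<in> fst d \<Longrightarrow> coord_vec A c u p d = trans_deriv c d p u"
  by (simp add: coord_vec_def trans_deriv_def)

lemma coord_vec_self [simp]: "c \<in> A \<Longrightarrow> p \<in> fst c \<Longrightarrow> coord_vec A c u p c = u"
  by (simp add: coord_vec_apply trans_deriv_self)

section \<open>Tangent spaces and coordinate vectors\<close>

lemma tangent_spaceI:
  assumes "\<And>c. \<not> (c \<in> A \<and> p \<in> fst c) \<Longrightarrow> v c = 0"
    and "\<And>c d. c \<in> A \<Longrightarrow> d \<in> A \<Longrightarrow> p \<in> fst c \<Longrightarrow> p \<in> fst d \<Longrightarrow> v d = trans_deriv c d p (v c)"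
  shows "v \<in> tangent_space A p"
  unfolding tangent_space_def using assms[unfolded trans_deriv_def] by blast

lemma tangent_space_outside: "v \<in> tangent_space A p \<Longrightarrow> \<not> (c \<in> A \<and> p \<in> fst c) \<Longrightarrow> v c = 0"
  unfolding tangent_space_def by blast

lemma tangent_space_change:
  "v \<in> tangent_space A p \<Longrightarrow> c \<in> A \<Longrightarrow> d \<in> A \<Longrightarrow> p \<in> fst c \<Longrightarrow> p \<in> fst d \<Longrightarrow>
    v d = trans_deriv c d p (v c)"
  unfolding tangent_space_def trans_deriv_def by blast

lemma coord_vec_tangent [simp]:
  assumes "c \<in> A" "p \<in> fst c"
  shows "coord_vec A c u p \<in> tangent_space A p"
proof (rule tangent_spaceI)
  show "coord_vec A c u p d = 0" if "\<not> (d \<in> A \<and> p \<in> fst d)" for d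
    using that by (auto simp: coord_vec_def)
qed (use assms in \<open>simp add: coord_vec_apply trans_deriv_cocycle\<close>)

text \<open>Transition differentials carry the component in \<open>c\<close> to every other chart
  around \<open>p\<close>, and elsewhere both families are 0. Identities between tangent vectors can
  thus be checked in a single chart.\<close>

lemma tangent_eqI:
  assumes "c \<in> A" "p \<in> fst c" "v \<in> tangent_space A p" "w \<in> tangent_space A p" "v c = w c"
  shows "v = w"
proof
  fix d
  show "v d = w d"
  proof (cases "d \<in> A \<and> p \<in> fst d")
    case True
    then show ?thesis
      using assms tangent_space_change[of v p c d] tangent_space_change[of w p c d] by auto
  next
    case False
    then show ?thesis
      using tangent_space_outside[OF assms(3)] tangent_space_outside[OF assms(4)] by metis
  qed
qed

lemma coord_vec_component [simp]:
  "c \<in> A \<Longrightarrow> p \<in> fst c \<Longrightarrow> v \<in> tangent_space A p \<Longrightarrow> coord_vec A c (v c) p = v"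
  by (rule tangent_eqI) auto

lemma tangent_space_add [simp]:
  assumes "v \<in> tangent_space A p" "w \<in> tangent_space A p"
  shows "v + w \<in> tangent_space A p"
proof (rule tangent_spaceI)
  show "(v + w) d = trans_deriv c d p ((v + w) c)"
    if "c \<in> A" "d \<in> A" "p \<in> fst c" "p \<in> fst d" for c d
    using linear_add[OF linear_trans_deriv[OF that]] tangent_space_change[OF assms(1) that]
      tangent_space_change[OF assms(2) that] by simp
qed (simp add: tangent_space_outside[OF assms(1)] tangent_space_outside[OF assms(2)])

lemma tangent_space_tscale [simp]:
  assumes "v \<in> tangent_space A p"
  shows "tscale a v \<in> tangent_space A p"
proof (rule tangent_spaceI)
  show "tscale a v d = trans_deriv c d p (tscale a v c)"
    if "c \<in> A" "d \<in> A" "p \<in> fst c" "p \<in> fst d" for c d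
    using linear_scale[OF linear_trans_deriv[OF that]] tangent_space_change[OF assms that]
    by (simp add: tscale_def)
qed (simp add: tangent_space_outside[OF assms] tscale_def)

lemma coord_vec_add:
  "c \<in> A \<Longrightarrow> p \<in> fst c \<Longrightarrow> coord_vec A c (u + w) p = coord_vec A c u p + coord_vec A c w p"
  by (rule tangent_eqI[of c]) auto

lemma coord_vec_scale:
  "c \<in> A \<Longrightarrow> p \<in> fst c \<Longrightarrow> coord_vec A c (a *\<^sub>R u) p = tscale a (coord_vec A c u p)"
  by (rule tangent_eqI[of c]) (auto simp: tscale_apply)

section \<open>Smooth fields and derivatives along tangent vectors\<close>

lemma smooth_field_tangent: "smooth_field A W X \<Longrightarrow> p \<in> W \<Longrightarrow> X p \<in> tangent_space A p"
  by (simp add: smooth_field_def)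

lemma smooth_field_subset:
  assumes "smooth_field A W X" "U \<subseteq> W"
  shows "smooth_field A U X"
proof -
  have "smooth_on (snd c ` (fst c \<inter> U)) (\<lambda>x. X (chart_inv c x) c)" if "c \<in> A" for c
  proof (rule smooth_on_subset)
    show "smooth_on (snd c ` (fst c \<inter> W)) (\<lambda>x. X (chart_inv c x) c)"
      using assms(1) that by (simp add: smooth_field_def)
  qed (use assms(2) in auto)
  then show ?thesis
    using assms by (auto simp: smooth_field_def)
qed

lemma smooth_field_coord_vec:
  assumes "c \<in> A"
  shows "smooth_field A (fst c) (coord_vec A c u)"
  unfolding smooth_field_def
proof (intro conjI ballI)
  fix d assume "d \<in> A"
  let ?S = "snd d ` (fst d \<inter> fst c)" and ?T = "snd c ` (fst c \<inter> fst d)"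
  have op: "open ?S" "open ?T"
    using assms \<open>d \<in> A\<close> open_chart_image open_chart by auto
  show "smooth_on ?S (\<lambda>x. coord_vec A c u (chart_inv d x) d)"
  proof (rule smooth_on_cong[OF op(1)])
    \<comment> \<open>Read in \<open>d\<close>, the component is a derivative of the transition from
      \<open>c\<close> in the fixed direction \<open>u\<close>, evaluated at the
      \<open>c\<close>-coordinates of the point.\<close>
    show "smooth_on ?S ((\<lambda>y. frechet_derivative (snd d \<circ> chart_inv c) (at y) u) \<circ> (snd c \<circ> chart_inv d))"
    proof (rule smooth_on_compose[OF op])
      show "(snd c \<circ> chart_inv d) ` ?S \<subseteq> ?T" using \<open>d \<in> A\<close> by auto
    qed (use assms \<open>d \<in> A\<close> smooth_transition smooth_on_frechet in blast)+
  qed (use \<open>d \<in> A\<close> in \<open>auto simp: coord_vec_def\<close>)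
qed (use assms in simp)

lemma smooth_fun_differentiable:
  assumes "smooth_fun A W f" "c \<in> A" "p \<in> fst c" "p \<in> W"
  shows "(f \<circ> chart_inv c) differentiable at (snd c p)"
  using assms smooth_on_differentiable[of "snd c ` (fst c \<inter> W)" "f \<circ> chart_inv c" "snd c p"]
  unfolding smooth_fun_def by blast

text \<open>Frees \<open>tderiv\<close> from the chart picked by \<open>SOME\<close>: the chain rule
  for the chart change cancels against the transformation rule of tangent vectors.\<close>

lemma tderiv_chart:
  assumes "v \<in> tangent_space A p" "c \<in> A" "p \<in> fst c"
    and "((f \<circ> chart_inv c) has_derivative F) (at (snd c p))"
  shows "tderiv A p v f = F (v c)"
proof -
  define d where "d = (SOME c. c \<in> A \<and> p \<in> fst c)"
  have d: "d \<in> A" "p \<in> fst d"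
    using someI[of "\<lambda>c. c \<in> A \<and> p \<in> fst c" c] assms by (auto simp: d_def)
  have "((f \<circ> chart_inv d) has_derivative F \<circ> trans_deriv d c p) (at (snd d p))"
    using has_derivative_change_chart[OF d(1) assms(2) d(2) assms(3,4)] .
  then show ?thesis
    using tangent_space_change[OF assms(1) d(1) assms(2) d(2) assms(3)]
    by (simp add: tderiv_def Let_def d_def[symmetric] has_derivative_imp_frechet)
qed

lemma has_derivative_tderiv:
  assumes "smooth_fun A W f" "c \<in> A" "p \<in> fst c" "p \<in> W"
  shows "((f \<circ> chart_inv c) has_derivative (\<lambda>u. tderiv A p (coord_vec A c u p) f)) (at (snd c p))"
proof -
  have D: "((f \<circ> chart_inv c) has_derivative frechet_derivative (f \<circ> chart_inv c) (at (snd c p)))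
      (at (snd c p))"
    using smooth_fun_differentiable[OF assms] by (rule differentiable_has_frechet)
  show ?thesis
    using D tderiv_chart[OF coord_vec_tangent[OF assms(2,3)] assms(2,3) D] assms by simp
qed

end

section \<open>Metric and connection\<close>

locale riemannian_mfd = smooth_mfd A
  for A :: "('m::{t2_space,second_countable_topology}, 'e::euclidean_space) chart set" +
  fixes g :: "('m, 'e) metric"
  assumes metric: "riemannian_metric A g"
begin

lemma
  assumes "u \<in> tangent_space A p" "v \<in> tangent_space A p"
  shows g_sym: "g p u v = g p v u"
    and g_scale_left: "g p (tscale a u) v = a * g p u v"
    and g_pos: "u \<noteq> 0 \<Longrightarrow> g p u u > 0"
  using metric assms unfolding riemannian_metric_def by blast+

lemma g_add_left:
  assumes "u \<in> tangent_space A p" "v \<in> tangent_space A p" "w \<in> tangent_space A p"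
  shows "g p (u + v) w = g p u w + g p v w"
  using metric assms unfolding riemannian_metric_def by blast

lemma g_scale_right:
  assumes "u \<in> tangent_space A p" "v \<in> tangent_space A p"
  shows "g p u (tscale a v) = a * g p u v"
  using g_scale_left[OF assms(2,1)] g_sym[OF assms] g_sym[of "tscale a v" p u] assms by simp

text \<open>Tangent spaces are sets of families, while \<open>linear\<close> speaks of maps on a
  whole type. Parametrizing the tangent space by \<open>'e\<close> through \<open>coord_vec\<close>
  makes linear algebra on \<open>'e\<close> applicable.\<close>

lemma linear_g_coord_left:
  assumes "c \<in> A" "p \<in> fst c" "w \<in> tangent_space A p"
  shows "linear (\<lambda>u. g p (coord_vec A c u p) w)"
  using assms by (intro linearI) (simp_all add: coord_vec_add coord_vec_scale g_add_left g_scale_left)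

lemma linear_g_coord_right:
  assumes "c \<in> A" "p \<in> fst c" "w \<in> tangent_space A p"
  shows "linear (\<lambda>u. g p w (coord_vec A c u p))"
  using linear_g_coord_left[OF assms] g_sym[OF assms(3) coord_vec_tangent[OF assms(1,2)]] by simp

lemma g_zero_left:
  assumes "p \<in> fst c" "c \<in> A" "w \<in> tangent_space A p"
  shows "g p 0 w = 0"
  \<comment> \<open>\<open>coord_vec_add\<close> with second summand 0 forces
    \<open>coord_vec A c 0 p\<close> to be the zero family.\<close>
  using linear_0[OF linear_g_coord_left[OF assms(2,1,3)]] assms
  by (metis coord_vec_add add.right_neutral add_cancel_right_right)

lemma g_coord_sum_left:
  assumes "c \<in> A" "p \<in> fst c" "v \<in> tangent_space A p" "w \<in> tangent_space A p"
  shows "g p v w = (\<Sum>b\<in>Basis. (v c \<bullet> b) * g p (coord_vec A c b p) w)"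
  using linear_sum_Basis[OF linear_g_coord_left[OF assms(1,2,4)], of "v c"] assms by simp

lemma g_coord_sum_right:
  assumes "c \<in> A" "p \<in> fst c" "v \<in> tangent_space A p" "w \<in> tangent_space A p"
  shows "g p w v = (\<Sum>b\<in>Basis. (v c \<bullet> b) * g p w (coord_vec A c b p))"
  using linear_sum_Basis[OF linear_g_coord_right[OF assms(1,2,4)], of "v c"] assms by simp

text \<open>Testing with \<open>z\<close> equal to the difference of \<open>v\<close> and
  \<open>w\<close> makes its squared length 0. The difference is written with
  \<open>tscale (-1)\<close> because the metric axioms speak of sums and
  \<open>tscale\<close>.\<close>

lemma tangent_eq_if_g_eq:
  assumes "v \<in> tangent_space A p" "w \<in> tangent_space A p"
    and "\<And>z. z \<in> tangent_space A p \<Longrightarrow> g p v z = g p w z"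
  shows "v = w"
proof -
  have mem: "tscale (-1) w \<in> tangent_space A p" using assms(2) by simp
  have diff: "v + tscale (-1) w \<in> tangent_space A p" using assms(1) mem by simp
  have "g p (v + tscale (-1) w) (v + tscale (-1) w) = 0"
    using g_add_left[OF assms(1) mem diff] g_scale_left[OF assms(2) diff, of "-1"] assms(3)[OF diff]
    by simp
  then have zero: "v + tscale (-1) w = 0" using g_pos[OF diff diff] by fastforce
  have "v c = w c" for c
    using fun_cong[OF zero, of c] by (simp add: tscale_apply)
  then show ?thesis by auto
qed

text \<open>The metric is known to be smooth on pairs of coordinate fields. Expanding both fields in
  the coordinate frame of \<open>c\<close> gives a double sum of products of smooth
  functions.\<close>

lemma smooth_fun_g:
  assumes "open W" "smooth_field A W X" "smooth_field A W Y"
  shows "smooth_fun A W (\<lambda>q. g q (X q) (Y q))"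
  unfolding smooth_fun_def
proof
  fix c assume c: "c \<in> A"
  let ?S = "snd c ` (fst c \<inter> W)"
  let ?G = "\<lambda>b b'. (\<lambda>q. g q (coord_vec A c b q) (coord_vec A c b' q)) \<circ> chart_inv c"
  have op: "open ?S" using c assms(1) by (rule open_chart_image)
  have G: "smooth_on ?S (?G b b')" for b b'
  proof (rule smooth_on_subset)
    show "smooth_on (snd c ` (fst c \<inter> fst c)) (?G b b')"
      using metric c unfolding riemannian_metric_def smooth_fun_def by blast
  qed auto
  have XY: "smooth_on ?S (\<lambda>x. X (chart_inv c x) c)" "smooth_on ?S (\<lambda>x. Y (chart_inv c x) c)"
    using assms c by (auto simp: smooth_field_def)
  show "smooth_on ?S ((\<lambda>q. g q (X q) (Y q)) \<circ> chart_inv c)"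
  proof (rule smooth_on_cong[OF op])
    show "smooth_on ?S (\<lambda>x. \<Sum>b\<in>Basis. (X (chart_inv c x) c \<bullet> b) *
        (\<Sum>b'\<in>Basis. (Y (chart_inv c x) c \<bullet> b') * ?G b b' x))"
      by (intro smooth_on_linear_combination op XY G)
    fix x assume "x \<in> ?S"
    then obtain q where q: "q \<in> fst c" "q \<in> W" "x = snd c q" by blast
    have t: "X q \<in> tangent_space A q" "Y q \<in> tangent_space A q"
      using assms q smooth_field_tangent by blast+
    show "(\<Sum>b\<in>Basis. (X (chart_inv c x) c \<bullet> b) *
        (\<Sum>b'\<in>Basis. (Y (chart_inv c x) c \<bullet> b') * ?G b b' x))
        = ((\<lambda>q. g q (X q) (Y q)) \<circ> chart_inv c) x"
      using q c t g_coord_sum_left[OF c q(1) t] g_coord_sum_right[OF c q(1) t(2) coord_vec_tangent[OF c q(1)]]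
      by simp
  qed
qed

text \<open>The Riesz representation on the tangent space, needed because \<open>gradient\<close> is a definite
  description.\<close>

lemma gradient_works:
  assumes "smooth_fun A W f" "p \<in> W"
  shows "gradient A g f p \<in> tangent_space A p"
    and "v \<in> tangent_space A p \<Longrightarrow> g p (gradient A g f p) v = tderiv A p v f"
proof -
  obtain c where c: "c \<in> A" "p \<in> fst c" by (rule ex_chart)
  let ?B = "\<lambda>u w. g p (coord_vec A c u p) (coord_vec A c w p)"
  \<comment> \<open>\<open>L\<close> is the Gram operator of the metric at \<open>p\<close>: its
    inner product with \<open>w\<close> is \<open>?B u w\<close>. Positive definiteness makes it
    injective, hence surjective in finite dimension, and a preimage of the coordinate differential
    of \<open>f\<close> gives the gradient.\<close>
  define L where "L u = (\<Sum>b\<in>Basis. ?B u b *\<^sub>R b)" for u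
  have linL: "linear L"
    unfolding L_def
    by (intro linearI) (simp_all add: linear_add[OF linear_g_coord_left[OF c coord_vec_tangent[OF c]]]
        linear_scale[OF linear_g_coord_left[OF c coord_vec_tangent[OF c]]]
        scaleR_add_left sum.distrib scaleR_sum_right)
  have L_inner: "L u \<bullet> w = ?B u w" for u w
    using linear_sum_Basis[OF linear_g_coord_right[OF c coord_vec_tangent[OF c]], of u w]
    by (simp add: L_def inner_sum_left inner_commute[of w] mult.commute)
  have "u = 0" if "L u = 0" for u
  proof (rule ccontr)
    assume "u \<noteq> 0"
    then have "coord_vec A c u p \<noteq> 0" using coord_vec_self[OF c, of u] by (metis zero_fun_def)
    then show False
      using g_pos[OF coord_vec_tangent[OF c] coord_vec_tangent[OF c]] L_inner[of u u] that by fastforce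
  qed
  then have "surj L"
    using linear_injective_imp_surjective[OF linL] linear_injective_0[OF linL] by simp
  let ?T = "\<lambda>u. tderiv A p (coord_vec A c u p) f"
  have linT: "linear ?T"
    using has_derivative_tderiv[OF assms(1) c assms(2)] has_derivative_linear by blast
  obtain u where u: "L u = (\<Sum>b\<in>Basis. ?T b *\<^sub>R b)" 
    using surjD[OF \<open>surj L\<close>, of "\<Sum>b\<in>Basis. ?T b *\<^sub>R b"] by auto
  let ?P = "\<lambda>w. w \<in> tangent_space A p \<and> (\<forall>v\<in>tangent_space A p. g p w v = tderiv A p v f)"
  have "?P (coord_vec A c u p)"
  proof (intro conjI ballI)
    fix v assume v: "v \<in> tangent_space A p"
    have "g p (coord_vec A c u p) v = L u \<bullet> v c" using v c by (simp add: L_inner)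
    also have "\<dots> = ?T (v c)"
      using linear_sum_Basis[OF linT, of "v c"]
      by (simp add: u inner_sum_left inner_commute[of "v c"] mult.commute)
    finally show "g p (coord_vec A c u p) v = tderiv A p v f" using v c by simp
  qed (use c in simp)
  moreover have "w = coord_vec A c u p" if "?P w" for w
    using that calculation by (intro tangent_eq_if_g_eq[of w p]) auto
  ultimately have P: "?P (gradient A g f p)"
    unfolding gradient_def by (rule theI)
  show "gradient A g f p \<in> tangent_space A p" using P by blast
  show "v \<in> tangent_space A p \<Longrightarrow> g p (gradient A g f p) v = tderiv A p v f" using P by blast
qed

end

locale levi_civita_mfd = riemannian_mfd A g
  for A :: "('m::{t2_space,second_countable_topology}, 'e::euclidean_space) chart set" and g +
  fixes D :: "('m, 'e) conn"
  assumes lc: "levi_civita A g D"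
begin

lemma D_tangent:
  assumes "open W" "smooth_field A W Y" "p \<in> W" "v \<in> tangent_space A p"
  shows "D p v Y \<in> tangent_space A p"
  using lc assms unfolding levi_civita_def affine_connection_def by blast

lemma D_coord_vec_tangent:
  assumes "c \<in> A" "p \<in> fst c" "v \<in> tangent_space A p"
  shows "D p v (coord_vec A c u) \<in> tangent_space A p"
  using assms D_tangent[OF open_chart smooth_field_coord_vec] by blast

lemma metric_compat:
  assumes "open W" "smooth_field A W X" "smooth_field A W Y" "p \<in> W" "v \<in> tangent_space A p"
  shows "tderiv A p v (\<lambda>q. g q (X q) (Y q)) = g p (D p v X) (Y p) + g p (X p) (D p v Y)"
  using lc assms unfolding levi_civita_def by blast

text \<open>The two fields are smooth on different open sets, so compatibility is applied on the
  intersection, which still contains \<open>p\<close>.\<close>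

lemma metric_compat_coord:
  assumes "open W" "smooth_field A W X" "p \<in> W" "v \<in> tangent_space A p" "c \<in> A" "p \<in> fst c"
  shows "tderiv A p v (\<lambda>q. g q (X q) (coord_vec A c u q))
    = g p (D p v X) (coord_vec A c u p) + g p (X p) (D p v (coord_vec A c u))"
proof (rule metric_compat)
  show "open (W \<inter> fst c)" using assms open_chart by blast
  show "smooth_field A (W \<inter> fst c) X" using assms(2) by (rule smooth_field_subset) auto
  show "smooth_field A (W \<inter> fst c) (coord_vec A c u)"
    by (rule smooth_field_subset[OF smooth_field_coord_vec]) (use assms in auto)
qed (use assms in auto)

text \<open>Both coordinate fields have constant components in \<open>c\<close> on the chart domain,
  so their bracket has zero component there; vanishing torsion gives the symmetry.\<close>

lemma D_coord_vec_sym: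
  assumes "c \<in> A" "p \<in> fst c"
  shows "D p (coord_vec A c u p) (coord_vec A c w) = D p (coord_vec A c w p) (coord_vec A c u)"
proof (rule tangent_eqI[OF assms])
  have const: "frechet_derivative (\<lambda>x. coord_vec A c u (chart_inv c x) c) (at (snd c p)) = (\<lambda>_. 0)"
    for u
  proof -
    have "coord_vec A c u (chart_inv c x) c = u" if "x \<in> snd c ` fst c" for x
      using that assms(1) by auto
    from frechet_derivative_cong_open[OF open_chart_range[OF assms(1)] _ this]
    show ?thesis using assms by simp
  qed
  have "D p (coord_vec A c u p) (coord_vec A c w) - D p (coord_vec A c w p) (coord_vec A c u)
      = lie_bracket A (coord_vec A c u) (coord_vec A c w) p"
    using lc smooth_field_coord_vec open_chart assms unfolding levi_civita_def by blast
  from fun_cong[OF this, of c]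
  show "D p (coord_vec A c u p) (coord_vec A c w) c = D p (coord_vec A c w p) (coord_vec A c u) c"
    using assms by (simp add: lie_bracket_def const)
qed (use assms D_coord_vec_tangent in auto)

text \<open>Away from the chart domain \<open>coord_vec A c u\<close> has junk values and is not linear in \<open>u\<close>, so
  linearity of \<open>D p v\<close> does not apply. Metric compatibility sees only the germ at \<open>p\<close>.\<close>

lemma linear_g_D_coord_vec:
  assumes "c \<in> A" "p \<in> fst c" "v \<in> tangent_space A p" "z \<in> tangent_space A p"
  shows "linear (\<lambda>u. g p z (D p v (coord_vec A c u)))"
proof -
  \<comment> \<open>\<open>z\<close> is extended to the coordinate field with the same component in
    \<open>c\<close>. Metric compatibility then expresses the form in question as the derivative of
    \<open>?h u\<close> minus a metric term, both linear in \<open>u\<close>.\<close>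
  let ?h = "\<lambda>u q. g q (coord_vec A c (z c) q) (coord_vec A c u q)"
  have sm: "smooth_fun A (fst c) (?h u)" for u
    using assms by (intro smooth_fun_g open_chart smooth_field_coord_vec)
  have D: "(?h u \<circ> chart_inv c has_derivative (\<lambda>w. tderiv A p (coord_vec A c w p) (?h u))) (at (snd c p))"
    for u using has_derivative_tderiv[OF sm assms(1,2,2)] .
  have lin: "linear (\<lambda>u. ?h u q)" if "q \<in> fst c" for q
    using assms that by (intro linear_g_coord_right) auto
  have "tderiv A p v (?h (u + w)) = tderiv A p v (?h u) + tderiv A p v (?h w)" for u w
  proof -
    have "(?h (u + w) \<circ> chart_inv c has_derivative (\<lambda>x. tderiv A p (coord_vec A c x p) (?h u)
        + tderiv A p (coord_vec A c x p) (?h w))) (at (snd c p))"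
      by (rule has_derivative_transform_within_open[OF has_derivative_add[OF D D]
            open_chart_range[OF assms(1)]])
        (use assms in \<open>auto simp: linear_add[OF lin]\<close>)
    from tderiv_chart[OF assms(3,1,2) this] show ?thesis using assms by simp
  qed
  moreover have "tderiv A p v (?h (r *\<^sub>R u)) = r * tderiv A p v (?h u)" for r u
  proof -
    have "(?h (r *\<^sub>R u) \<circ> chart_inv c has_derivative (\<lambda>x. r *\<^sub>R tderiv A p (coord_vec A c x p) (?h u)))
        (at (snd c p))"
      by (rule has_derivative_transform_within_open[OF has_derivative_scaleR_right[OF D]
            open_chart_range[OF assms(1)]])
        (use assms in \<open>auto simp: linear_scale[OF lin]\<close>)
    from tderiv_chart[OF assms(3,1,2) this] show ?thesis using assms by simp
  qed
  ultimately have "linear (\<lambda>u. tderiv A p v (?h u))"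
    by (intro linearI) auto
  moreover have "linear (\<lambda>u. g p (D p v (coord_vec A c (z c))) (coord_vec A c u p))"
    using assms by (intro linear_g_coord_right D_coord_vec_tangent)
  ultimately have "linear (\<lambda>u. tderiv A p v (?h u) - g p (D p v (coord_vec A c (z c))) (coord_vec A c u p))"
    by (rule linear_compose_sub)
  moreover have "tderiv A p v (?h u) = g p (D p v (coord_vec A c (z c))) (coord_vec A c u p)
      + g p z (D p v (coord_vec A c u))" for u
    using metric_compat_coord[OF open_chart smooth_field_coord_vec _ assms(3,1,2), of c "z c" u] assms
    by simp
  ultimately show ?thesis by simp
qed

end

section \<open>Geodesics\<close>

text \<open>The mean value theorem on each side of the intermediate point and once more for
  \<open>f'\<close> writes the gap between chord and graph as a positive multiple of one value of
  \<open>f''\<close>. Weak and strict convexity thus both reduce to the sign of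
  \<open>f''\<close>.\<close>

lemma second_order_chord:
  fixes f :: "real \<Rightarrow> real"
  assumes "a < b" "0 < t" "t < 1"
    and f: "\<And>x. x \<in> {a..b} \<Longrightarrow> (f has_real_derivative f' x) (at x within {a..b})"
    and f': "\<And>x. x \<in> {a..b} \<Longrightarrow> (f' has_real_derivative f'' x) (at x within {a..b})"
  obtains K \<zeta> where "K > 0" "\<zeta> \<in> {a..b}"
    "(1 - t) * f a + t * f b - f ((1 - t) * a + t * b) = K * f'' \<zeta>"
proof -
  have mvt: "\<exists>x\<in>{c<..<d}. h d - h c = h' x * (d - c)"
    if "c < d" "a \<le> c" "d \<le> b"
      and "\<And>x. x \<in> {a..b} \<Longrightarrow> (h has_real_derivative h' x) (at x within {a..b})"
    for c d and h h' :: "real \<Rightarrow> real"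
  proof (rule mvt_simple[OF that(1)])
    fix x assume "c \<le> x" "x \<le> d"
    then have "(h has_real_derivative h' x) (at x within {c..d})"
      using that by (intro DERIV_subset[OF that(4)]) auto
    then show "(h has_derivative (*) (h' x)) (at x within {c..d})"
      by (simp add: has_field_derivative_def)
  qed
  define s where "s = (1 - t) * a + t * b"
  have bs: "b - s = (1 - t) * (b - a)" and sa: "s - a = t * (b - a)"
    by (simp_all add: s_def algebra_simps)
  have "a < s" "s < b" using assms(1-3) bs sa
    by (metis diff_gt_0_iff_gt mult_pos_pos)+
  obtain \<xi> where \<xi>: "\<xi> \<in> {a<..<s}" "f s - f a = f' \<xi> * (s - a)"
    using mvt[OF \<open>a < s\<close> _ _ f] \<open>s < b\<close> by auto
  obtain \<eta> where \<eta>: "\<eta> \<in> {s<..<b}" "f b - f s = f' \<eta> * (b - s)"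
    using mvt[OF \<open>s < b\<close> _ _ f] \<open>a < s\<close> by auto
  have "\<xi> < \<eta>" using \<xi>(1) \<eta>(1) by auto
  then obtain \<zeta> where \<zeta>: "\<zeta> \<in> {\<xi><..<\<eta>}" "f' \<eta> - f' \<xi> = f'' \<zeta> * (\<eta> - \<xi>)"
    using mvt[OF \<open>\<xi> < \<eta>\<close> _ _ f'] \<xi>(1) \<eta>(1) by auto
  have "(1 - t) * f a + t * f b - f s = t * (f b - f s) - (1 - t) * (f s - f a)"
    by (simp add: algebra_simps)
  \<comment> \<open>Both increments acquire the same weight: \<open>t * (b - s)\<close> and
    \<open>(1 - t) * (s - a)\<close> are each \<open>t * (1 - t) * (b - a)\<close>.\<close>
  also have "\<dots> = t * (1 - t) * (b - a) * (f' \<eta> - f' \<xi>)"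
    unfolding \<xi>(2) \<eta>(2) bs sa by (simp add: algebra_simps)
  also have "\<dots> = (t * (1 - t) * (b - a) * (\<eta> - \<xi>)) * f'' \<zeta>"
    unfolding \<zeta>(2) by simp
  finally have "(1 - t) * f a + t * f b - f s = (t * (1 - t) * (b - a) * (\<eta> - \<xi>)) * f'' \<zeta>" .
  moreover have "t * (1 - t) * (b - a) * (\<eta> - \<xi>) > 0"
    using assms(1-3) \<open>\<xi> < \<eta>\<close> by simp
  moreover have "\<zeta> \<in> {a..b}" using \<zeta>(1) \<xi>(1) \<eta>(1) by auto
  ultimately show ?thesis using that unfolding s_def by blast
qed

section \<open>Localizing derivatives along a continuous curve\<close>

lemma stays_near:
  fixes \<gamma> :: "real \<Rightarrow> 'a::topological_space"
  assumes "continuous_on I \<gamma>" "t \<in> I" "open U" "\<gamma> t \<in> U"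
  obtains e where "e > 0" "\<And>s. s \<in> I \<Longrightarrow> dist s t < e \<Longrightarrow> \<gamma> s \<in> U"
proof -
  have "\<forall>\<^sub>F s in at t within I. \<gamma> s \<in> U"
    using assms by (auto simp: continuous_on_def intro: topological_tendstoD)
  then obtain e where "e > 0" "\<And>s. s \<in> I \<Longrightarrow> s \<noteq> t \<and> dist s t < e \<Longrightarrow> \<gamma> s \<in> U"
    by (auto simp: eventually_at)
  then show ?thesis
    using that[of e] assms(4) by auto
qed

lemma has_vector_derivative_transform_along:
  fixes \<gamma> :: "real \<Rightarrow> 'a::topological_space"
  assumes "continuous_on I \<gamma>" "t \<in> I" "open U" "\<gamma> t \<in> U"
    and "\<And>s. s \<in> I \<Longrightarrow> \<gamma> s \<in> U \<Longrightarrow> f s = h s"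
    and "(f has_vector_derivative f') (at t within I)"
  shows "(h has_vector_derivative f') (at t within I)"
proof -
  obtain e where e: "e > 0" "\<And>s. s \<in> I \<Longrightarrow> dist s t < e \<Longrightarrow> \<gamma> s \<in> U"
    by (rule stays_near[OF assms(1-4)]) blast
  show ?thesis
    by (rule has_vector_derivative_transform_within[OF assms(6) e(1) assms(2)])
      (use assms(5) e(2) in auto)
qed

text \<open>\<open>geodesic_on\<close> differentiates within the set of times spent in a chart
  domain; this replaces that filter by the one of the whole interval.\<close>

lemma at_within_along:
  fixes \<gamma> :: "real \<Rightarrow> 'a::topological_space"
  assumes "continuous_on I \<gamma>" "t \<in> I" "open U" "\<gamma> t \<in> U"
  shows "at t within {s \<in> I. \<gamma> s \<in> U} = at t within I"
proof -
  obtain e where e: "e > 0" "\<And>s. s \<in> I \<Longrightarrow> dist s t < e \<Longrightarrow> \<gamma> s \<in> U"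
    by (rule stays_near[OF assms(1-4)]) blast
  show ?thesis
    by (rule at_within_nhd[of t "ball t e"]) (use e in \<open>auto simp: dist_commute\<close>)
qed

text \<open>The derivative is taken within \<open>I\<close>, hence one-sided at end points, and the
  entries for other charts are 0 as \<open>tangent_space\<close> demands.\<close>

definition (in smooth_mfd) velocity :: "real set \<Rightarrow> (real \<Rightarrow> 'm) \<Rightarrow> real \<Rightarrow> ('m, 'e) tvec" where
  "velocity I \<gamma> t = (\<lambda>c. if c \<in> A \<and> \<gamma> t \<in> fst c
     then vector_derivative (snd c \<circ> \<gamma>) (at t within I) else 0)"

locale geodesic_segment = levi_civita_mfd A g D
  for A :: "('m::{t2_space,second_countable_topology}, 'e::euclidean_space) chart set" and g D +
  fixes a b :: real and \<gamma> :: "real \<Rightarrow> 'm"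
  assumes ab: "a < b" and geodesic: "geodesic_on A D {a..b} \<gamma>"
begin

abbreviation "vel \<equiv> velocity {a..b} \<gamma>"

lemma cont: "continuous_on {a..b} \<gamma>"
  using geodesic by (simp add: geodesic_on_def)

lemma
  assumes "t \<in> {a..b}" "c \<in> A" "\<gamma> t \<in> fst c"
  shows has_vector_derivative_curve:
      "((snd c \<circ> \<gamma>) has_vector_derivative vel t c) (at t within {a..b})"
    and has_vector_derivative_vel:
      "((\<lambda>s. vel s c) has_vector_derivative - christoffel A D c (\<gamma> t) (vel t c) (vel t c))
        (at t within {a..b})"
proof -
  let ?J = "{s \<in> {a..b}. \<gamma> s \<in> fst c}"
  obtain x' where x': "\<And>s. s \<in> ?J \<Longrightarrow> ((snd c \<circ> \<gamma>) has_vector_derivative x' s) (at s within ?J)"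
    "\<And>s. s \<in> ?J \<Longrightarrow> (x' has_vector_derivative - christoffel A D c (\<gamma> s) (x' s) (x' s)) (at s within ?J)"
    using geodesic assms(2) unfolding geodesic_on_def Let_def by blast
  have at_J: "at s within ?J = at s within {a..b}" if "s \<in> ?J" for s
    using that by (intro at_within_along[OF cont _ open_chart[OF assms(2)]]) auto
  have vel: "vel s c = x' s" if "s \<in> ?J" for s
  proof -
    \<comment> \<open>Here \<open>a < b\<close> matters: derivatives within a nondegenerate interval
      are unique, so the function \<open>x'\<close> provided by the geodesic equation is the
      velocity component.\<close>
    have "vector_derivative (snd c \<circ> \<gamma>) (at s within cbox a b) = x' s"
      using x'(1)[OF that] at_J[OF that] that ab
      by (intro vector_derivative_within_cbox) auto
    then show ?thesis using that assms(2) by (simp add: velocity_def)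
  qed
  have t: "t \<in> ?J" using assms by simp
  show "((snd c \<circ> \<gamma>) has_vector_derivative vel t c) (at t within {a..b})"
    using x'(1)[OF t] at_J[OF t] vel[OF t] by simp
  show "((\<lambda>s. vel s c) has_vector_derivative - christoffel A D c (\<gamma> t) (vel t c) (vel t c))
        (at t within {a..b})"
  proof (rule has_vector_derivative_transform_along[OF cont assms(1) open_chart[OF assms(2)] assms(3)])
    show "x' s = vel s c" if "s \<in> {a..b}" "\<gamma> s \<in> fst c" for s
      using vel[of s] that by simp
    show "(x' has_vector_derivative - christoffel A D c (\<gamma> t) (vel t c) (vel t c)) (at t within {a..b})"
      using x'(2)[OF t] at_J[OF t] vel[OF t] by simp
  qed
qed

lemma has_vector_derivative_along:
  assumes "t \<in> {a..b}" "c \<in> A" "\<gamma> t \<in> fst c"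
    and "((f \<circ> chart_inv c) has_derivative F) (at (snd c (\<gamma> t)))"
  shows "((f \<circ> \<gamma>) has_vector_derivative F (vel t c)) (at t within {a..b})"
proof (rule has_vector_derivative_transform_along[OF cont assms(1) open_chart[OF assms(2)] assms(3)])
  show "((f \<circ> chart_inv c) \<circ> (snd c \<circ> \<gamma>) has_vector_derivative F (vel t c)) (at t within {a..b})"
  proof (rule vector_derivative_diff_chain_within[OF has_vector_derivative_curve[OF assms(1-3)]])
    show "((f \<circ> chart_inv c) has_derivative F) (at ((snd c \<circ> \<gamma>) t) within (snd c \<circ> \<gamma>) ` {a..b})"
      using has_derivative_at_withinI[OF assms(4)] by (simp del: o_apply add: o_apply[of "snd c" \<gamma> t])
  qed
qed (use assms in auto)

text \<open>Differentiating the chart map \<open>snd d\<close> along the curve by way of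
  \<open>c\<close> gives the transformation rule between the two components.\<close>

lemma vel_tangent [simp]:
  assumes "t \<in> {a..b}"
  shows "vel t \<in> tangent_space A (\<gamma> t)"
proof (rule tangent_spaceI)
  fix c d assume *: "c \<in> A" "d \<in> A" "\<gamma> t \<in> fst c" "\<gamma> t \<in> fst d"
  have "((snd d \<circ> \<gamma>) has_vector_derivative trans_deriv c d (\<gamma> t) (vel t c)) (at t within {a..b})"
    using * assms by (intro has_vector_derivative_along has_derivative_transition)
  then have "vector_derivative (snd d \<circ> \<gamma>) (at t within cbox a b) = trans_deriv c d (\<gamma> t) (vel t c)"
    using assms ab by (intro vector_derivative_within_cbox) auto
  then show "vel t d = trans_deriv c d (\<gamma> t) (vel t c)"
    using * by (simp add: velocity_def)
qed (auto simp: velocity_def)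

lemma has_real_derivative_along:
  assumes "t \<in> {a..b}" "smooth_fun A W f" "\<gamma> t \<in> W"
  shows "((\<lambda>s. f (\<gamma> s)) has_real_derivative tderiv A (\<gamma> t) (vel t) f) (at t within {a..b})"
proof -
  obtain c where c: "c \<in> A" "\<gamma> t \<in> fst c" by (rule ex_chart)
  show ?thesis
    using has_vector_derivative_along[OF assms(1) c has_derivative_tderiv[OF assms(2) c assms(3)]] c assms
    by (simp add: has_real_derivative_iff_has_vector_derivative comp_def)
qed

text \<open>Reads the Christoffel term of the geodesic equation as a covariant derivative of the
  coordinate field whose component is frozen at its value at time \<open>t\<close>.\<close>

lemma coord_vec_christoffel:
  assumes "c \<in> A" "\<gamma> t \<in> fst c" "t \<in> {a..b}"
  shows "coord_vec A c (christoffel A D c (\<gamma> t) (vel t c) (vel t c)) (\<gamma> t)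
    = D (\<gamma> t) (vel t) (coord_vec A c (vel t c))"
  using assms D_coord_vec_tangent[OF assms(1,2) vel_tangent[OF assms(3)]]
  by (simp add: christoffel_def)

text \<open>Expresses that the velocity is parallel, tested against a field \<open>Y\<close>. With
  the velocity expanded in the coordinate fields of a chart, the geodesic equation differentiates
  the components and metric compatibility the coefficients.\<close>

lemma has_real_derivative_g_vel:
  assumes "open W" "smooth_field A W Y" "t \<in> {a..b}" "\<gamma> t \<in> W"
  shows "((\<lambda>s. g (\<gamma> s) (Y (\<gamma> s)) (vel s)) has_real_derivative
    g (\<gamma> t) (D (\<gamma> t) (vel t) Y) (vel t)) (at t within {a..b})"
proof -
  obtain c where c: "c \<in> A" "\<gamma> t \<in> fst c" by (rule ex_chart)
  let ?p = "\<gamma> t" and ?v = "vel t"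
  let ?\<Gamma> = "christoffel A D c ?p (?v c) (?v c)"
  let ?h = "\<lambda>b q. g q (Y q) (coord_vec A c b q)"
  have Yp: "Y ?p \<in> tangent_space A ?p" using assms smooth_field_tangent by blast
  have sm: "smooth_fun A (W \<inter> fst c) (?h i)" for i
    using c open_chart[OF c(1)] assms(1)
    by (intro smooth_fun_g smooth_field_subset[OF assms(2)] smooth_field_subset[OF smooth_field_coord_vec])
      auto
  have h: "((\<lambda>s. ?h i (\<gamma> s)) has_real_derivative g ?p (D ?p ?v Y) (coord_vec A c i ?p)
      + g ?p (Y ?p) (D ?p ?v (coord_vec A c i))) (at t within {a..b})" for i
    using has_real_derivative_along[OF assms(3) sm, of i] c assms
      metric_compat_coord[OF assms(1,2,4) vel_tangent[OF assms(3)] c]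
    by simp
  have v: "((\<lambda>s. vel s c \<bullet> i) has_real_derivative - ?\<Gamma> \<bullet> i) (at t within {a..b})" for i
    using has_vector_derivative_vel[OF assms(3) c]
    by (auto simp: has_vector_derivative_def has_field_derivative_def
        intro!: derivative_eq_intros)
  have "((\<lambda>s. \<Sum>b\<in>Basis. (vel s c \<bullet> b) * ?h b (\<gamma> s)) has_real_derivative
      (\<Sum>b\<in>Basis. (- ?\<Gamma> \<bullet> b) * ?h b ?p + (g ?p (D ?p ?v Y) (coord_vec A c b ?p)
      + g ?p (Y ?p) (D ?p ?v (coord_vec A c b))) * (?v c \<bullet> b))) (at t within {a..b})"
    by (intro DERIV_sum DERIV_mult v h)
  also have "(\<Sum>b\<in>Basis. (- ?\<Gamma> \<bullet> b) * ?h b ?p + (g ?p (D ?p ?v Y) (coord_vec A c b ?p)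
      + g ?p (Y ?p) (D ?p ?v (coord_vec A c b))) * (?v c \<bullet> b))
    = (\<Sum>b\<in>Basis. (?v c \<bullet> b) * g ?p (D ?p ?v Y) (coord_vec A c b ?p))
      + (\<Sum>b\<in>Basis. (?v c \<bullet> b) * g ?p (Y ?p) (D ?p ?v (coord_vec A c b)))
      - (\<Sum>b\<in>Basis. (?\<Gamma> \<bullet> b) * ?h b ?p)"
    by (simp add: sum.distrib sum_subtractf algebra_simps sum_negf)
  also have "(\<Sum>b\<in>Basis. (?v c \<bullet> b) * g ?p (D ?p ?v Y) (coord_vec A c b ?p)) = g ?p (D ?p ?v Y) ?v"
    using g_coord_sum_right[OF c vel_tangent[OF assms(3)] D_tangent[OF assms(1,2,4) vel_tangent[OF assms(3)]]]
    by simp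
  also have "(\<Sum>b\<in>Basis. (?v c \<bullet> b) * g ?p (Y ?p) (D ?p ?v (coord_vec A c b)))
      = g ?p (Y ?p) (D ?p ?v (coord_vec A c (?v c)))"
    using linear_sum_Basis[OF linear_g_D_coord_vec[OF c vel_tangent[OF assms(3)] Yp], of "?v c"]
    by simp
  also have "(\<Sum>b\<in>Basis. (?\<Gamma> \<bullet> b) * ?h b ?p) = g ?p (Y ?p) (coord_vec A c ?\<Gamma> ?p)"
    using linear_sum_Basis[OF linear_g_coord_right[OF c Yp], of ?\<Gamma>] by simp
  finally have "((\<lambda>s. \<Sum>b\<in>Basis. (vel s c \<bullet> b) * ?h b (\<gamma> s)) has_real_derivative
      g ?p (D ?p ?v Y) ?v) (at t within {a..b})"
    using coord_vec_christoffel[OF c assms(3)] by simp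
  then have "((\<lambda>s. \<Sum>b\<in>Basis. (vel s c \<bullet> b) * ?h b (\<gamma> s)) has_vector_derivative
      g ?p (D ?p ?v Y) ?v) (at t within {a..b})"
    by (simp add: has_real_derivative_iff_has_vector_derivative)
  then show ?thesis
    unfolding has_real_derivative_iff_has_vector_derivative
  proof (rule has_vector_derivative_transform_along[OF cont assms(3), rotated -1])
    show "open (W \<inter> fst c)" using assms(1) open_chart[OF c(1)] by auto
    fix s assume s: "s \<in> {a..b}" "\<gamma> s \<in> W \<inter> fst c"
    then have "Y (\<gamma> s) \<in> tangent_space A (\<gamma> s)" using assms smooth_field_tangent by blast
    then show "(\<Sum>b\<in>Basis. (vel s c \<bullet> b) * ?h b (\<gamma> s)) = g (\<gamma> s) (Y (\<gamma> s)) (vel s)"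
      using g_coord_sum_right[OF c(1) _ vel_tangent[OF s(1)]] s(2) by simp
  qed (use c assms in auto)
qed

text \<open>The velocity is not a field, so it cannot take the place of \<open>Y\<close> above. Only
  its first occurrence is expanded; each coordinate field then serves as \<open>Y\<close>, and the
  same cancellation occurs.\<close>

lemma has_real_derivative_speed:
  assumes "t \<in> {a..b}"
  shows "((\<lambda>s. g (\<gamma> s) (vel s) (vel s)) has_real_derivative 0) (at t within {a..b})"
proof -
  obtain c where c: "c \<in> A" "\<gamma> t \<in> fst c" by (rule ex_chart)
  let ?p = "\<gamma> t" and ?v = "vel t"
  let ?\<Gamma> = "christoffel A D c ?p (?v c) (?v c)"
  have vt: "?v \<in> tangent_space A ?p" using assms by simp
  have h: "((\<lambda>s. g (\<gamma> s) (coord_vec A c i (\<gamma> s)) (vel s)) has_real_derivative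
    g ?p (D ?p ?v (coord_vec A c i)) ?v) (at t within {a..b})" for i
    using has_real_derivative_g_vel[OF open_chart smooth_field_coord_vec assms] c by blast
  have v: "((\<lambda>s. vel s c \<bullet> i) has_real_derivative - ?\<Gamma> \<bullet> i) (at t within {a..b})" for i
    using has_vector_derivative_vel[OF assms c]
    by (auto simp: has_vector_derivative_def has_field_derivative_def
        intro!: derivative_eq_intros)
  have "((\<lambda>s. \<Sum>b\<in>Basis. (vel s c \<bullet> b) * g (\<gamma> s) (coord_vec A c b (\<gamma> s)) (vel s)) has_real_derivative
      (\<Sum>b\<in>Basis. (- ?\<Gamma> \<bullet> b) * g ?p (coord_vec A c b ?p) ?v
        + g ?p (D ?p ?v (coord_vec A c b)) ?v * (?v c \<bullet> b))) (at t within {a..b})"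
    by (intro DERIV_sum DERIV_mult v h)
  also have "(\<Sum>b\<in>Basis. (- ?\<Gamma> \<bullet> b) * g ?p (coord_vec A c b ?p) ?v
        + g ?p (D ?p ?v (coord_vec A c b)) ?v * (?v c \<bullet> b))
     = (\<Sum>b\<in>Basis. (?v c \<bullet> b) * g ?p ?v (D ?p ?v (coord_vec A c b)))
      - (\<Sum>b\<in>Basis. (?\<Gamma> \<bullet> b) * g ?p (coord_vec A c b ?p) ?v)"
    using g_sym[OF vt D_coord_vec_tangent[OF c vt]]
    by (simp add: sum.distrib sum_subtractf algebra_simps sum_negf)
  also have "(\<Sum>b\<in>Basis. (?v c \<bullet> b) * g ?p ?v (D ?p ?v (coord_vec A c b)))
      = g ?p ?v (D ?p ?v (coord_vec A c (?v c)))"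
    using linear_sum_Basis[OF linear_g_D_coord_vec[OF c vt vt], of "?v c"] by simp
  also have "(\<Sum>b\<in>Basis. (?\<Gamma> \<bullet> b) * g ?p (coord_vec A c b ?p) ?v) = g ?p (coord_vec A c ?\<Gamma> ?p) ?v"
    using linear_sum_Basis[OF linear_g_coord_left[OF c vt], of ?\<Gamma>] by simp
  finally have "((\<lambda>s. \<Sum>b\<in>Basis. (vel s c \<bullet> b) * g (\<gamma> s) (coord_vec A c b (\<gamma> s)) (vel s))
      has_vector_derivative 0) (at t within {a..b})"
    using coord_vec_christoffel[OF c assms] g_sym[OF vt D_coord_vec_tangent[OF c vt]]
    by (simp add: has_real_derivative_iff_has_vector_derivative)
  then show ?thesis
    unfolding has_real_derivative_iff_has_vector_derivative
  proof (rule has_vector_derivative_transform_along[OF cont assms open_chart[OF c(1)] c(2), rotated -1])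
    fix s assume s: "s \<in> {a..b}" "\<gamma> s \<in> fst c"
    then show "(\<Sum>b\<in>Basis. (vel s c \<bullet> b) * g (\<gamma> s) (coord_vec A c b (\<gamma> s)) (vel s))
        = g (\<gamma> s) (vel s) (vel s)"
      using g_coord_sum_left[OF c(1) _ vel_tangent[OF s(1)] vel_tangent[OF s(1)]] by simp
  qed
qed

text \<open>Constant speed and positive definiteness spread one zero of the velocity over the whole
  interval. Coordinates are then constant on short pieces inside a chart, so the curve is locally
  constant on a connected set.\<close>

lemma constant_if_vel_zero:
  assumes "t \<in> {a..b}" "vel t = 0"
  shows "\<gamma> constant_on {a..b}"
proof (rule locally_constant_imp_constant)
  show "connected {a..b}" by (rule connected_Icc)
  have "\<exists>C. \<forall>s\<in>{a..b}. g (\<gamma> s) (vel s) (vel s) = C"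
    using has_real_derivative_speed
    by (intro has_derivative_zero_constant) (auto simp: has_field_derivative_def lambda_zero[symmetric])
  then obtain C where C: "\<And>s. s \<in> {a..b} \<Longrightarrow> g (\<gamma> s) (vel s) (vel s) = C" by blast
  obtain d where d: "d \<in> A" "\<gamma> t \<in> fst d" by (rule ex_chart)
  have "g (\<gamma> t) (vel t) (vel t) = 0"
    using g_zero_left[OF d(2,1) vel_tangent[OF assms(1)]] assms(2) by simp
  then have speed: "g (\<gamma> s) (vel s) (vel s) = 0" if "s \<in> {a..b}" for s
    using C[OF that] C[OF assms(1)] by simp
  have vel: "vel s = 0" if "s \<in> {a..b}" for s
    using g_pos[OF vel_tangent[OF that] vel_tangent[OF that]] speed[OF that] by fastforce
  fix r assume r: "r \<in> {a..b}"
  obtain c where c: "c \<in> A" "\<gamma> r \<in> fst c" by (rule ex_chart)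
  obtain e where e: "e > 0" "\<And>s. s \<in> {a..b} \<Longrightarrow> dist s r < e \<Longrightarrow> \<gamma> s \<in> fst c"
    by (rule stays_near[OF cont r open_chart[OF c(1)] c(2)]) blast
  let ?T = "{a..b} \<inter> ball r e"
  have inc: "\<gamma> s \<in> fst c" if "s \<in> ?T" for s
    using that e(2) by (simp add: dist_commute)
  have "\<exists>x. \<forall>s\<in>?T. (snd c \<circ> \<gamma>) s = x"
  proof (rule has_derivative_zero_constant)
    show "convex ?T" by (intro convex_Int) auto
    fix s assume s: "s \<in> ?T"
    then have "((snd c \<circ> \<gamma>) has_vector_derivative 0) (at s within {a..b})"
      using has_vector_derivative_curve[OF _ c(1) inc[OF s]] vel[of s] by simp
    then show "((snd c \<circ> \<gamma>) has_derivative (\<lambda>h. 0)) (at s within ?T)"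
      by (auto simp: has_vector_derivative_def intro: has_derivative_subset)
  qed
  then obtain x where x: "\<And>s. s \<in> ?T \<Longrightarrow> snd c (\<gamma> s) = x" by auto
  have "r \<in> ?T" using r e(1) by simp
  then have eq: "\<gamma> s = \<gamma> r" if "s \<in> ?T" for s
    using chart_inv_chart[OF c(1) inc[OF that]] chart_inv_chart[OF c] x[OF that] x[of r] by simp
  show "\<exists>T. openin (top_of_set {a..b}) T \<and> r \<in> T \<and> (\<forall>x\<in>T. \<gamma> x = \<gamma> r)"
  proof (intro exI conjI ballI)
    show "openin (top_of_set {a..b}) ?T" by (intro openin_open_Int) simp
    show "r \<in> ?T" by fact
    show "\<gamma> x = \<gamma> r" if "x \<in> ?T" for x using that by (rule eq)
  qed
qed

end

section \<open>Closed conformal fields\<close>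

locale closed_conformal_field = levi_civita_mfd A g D
  for A :: "('m::{t2_space,second_countable_topology}, 'e::euclidean_space) chart set" and g D +
  fixes V :: "'m \<Rightarrow> ('m, 'e) tvec" and \<phi> :: "'m \<Rightarrow> real"
  assumes V: "smooth_field A UNIV V" and \<phi>: "smooth_fun A UNIV \<phi>"
    and conformal: "closed_conformal A D V \<phi>"
begin

lemma V_tangent [simp]: "V p \<in> tangent_space A p"
  using V by (simp add: smooth_field_tangent)

lemma D_V: "v \<in> tangent_space A p \<Longrightarrow> D p v V = tscale (\<phi> p) v"
  using conformal by (simp add: closed_conformal_def)

lemma smooth_fun_norm2: "smooth_fun A UNIV (\<lambda>q. g q (V q) (V q))"
  by (intro smooth_fun_g V) simp

lemma tderiv_norm2:
  assumes "v \<in> tangent_space A p"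
  shows "tderiv A p v (\<lambda>q. g q (V q) (V q)) = 2 * (\<phi> p * g p (V p) v)"
  using metric_compat[OF open_UNIV V V UNIV_I assms] assms
  by (simp add: D_V g_scale_left g_scale_right g_sym[of v p "V p"])

text \<open>Computes the coordinate Hessian of \<langle>V, V\<rangle>. Apart from the term with the
  derivative of \<open>\<phi>\<close>, everything in \<open>second\<close> is symmetric in
  \<open>x\<close> and \<open>y\<close>, by symmetry of the metric and
  \<open>D_coord_vec_sym\<close>; as the Hessian is symmetric, so is that remaining term.\<close>

lemma dphi_wedge_V:
  assumes v: "v \<in> tangent_space A p" and w: "w \<in> tangent_space A p"
  shows "tderiv A p w \<phi> * g p (V p) v = tderiv A p v \<phi> * g p (V p) w"
proof -
  obtain c where c: "c \<in> A" "p \<in> fst c" by (rule ex_chart)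
  let ?N = "\<lambda>q. g q (V q) (V q)"
  let ?F = "?N \<circ> chart_inv c" and ?x = "snd c p" and ?S = "snd c ` fst c"
  let ?h = "\<lambda>u q. g q (V q) (coord_vec A c u q)"
  have op: "open ?S" using c open_chart_range by blast
  have smF: "smooth_on ?S ?F"
    using smooth_fun_norm2 c unfolding smooth_fun_def by (metis Int_UNIV_right)
  have dF: "frechet_derivative ?F (at (snd c q)) u = 2 * (\<phi> q * ?h u q)" if "q \<in> fst c" for q u
    using has_derivative_imp_frechet[OF has_derivative_tderiv[OF smooth_fun_norm2 c(1) that UNIV_I]]
      tderiv_norm2[OF coord_vec_tangent[OF c(1) that]] by simp
  have second: "frechet_derivative (\<lambda>z. frechet_derivative ?F (at z) (x c)) (at ?x) (y c)
      = 2 * (tderiv A p y \<phi> * g p (V p) x + \<phi> p * (\<phi> p * g p y x + g p (V p) (D p y (coord_vec A c (x c)))))"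
    if x: "x \<in> tangent_space A p" and y: "y \<in> tangent_space A p" for x y
  proof -
    let ?u = "x c"
    have smh: "smooth_fun A (fst c) (?h ?u)"
      using c by (intro smooth_fun_g open_chart smooth_field_subset[OF V] smooth_field_coord_vec) auto
    have Dh: "(?h ?u \<circ> chart_inv c has_derivative (\<lambda>z. tderiv A p (coord_vec A c z p) (?h ?u))) (at ?x)"
      by (rule has_derivative_tderiv[OF smh c c(2)])
    have D\<phi>: "(\<phi> \<circ> chart_inv c has_derivative (\<lambda>z. tderiv A p (coord_vec A c z p) \<phi>)) (at ?x)"
      by (rule has_derivative_tderiv[OF \<phi> c UNIV_I])
    have D2: "((\<lambda>z. frechet_derivative ?F (at z) ?u) has_derivative
        (\<lambda>z. 2 * ((\<phi> \<circ> chart_inv c) ?x * tderiv A p (coord_vec A c z p) (?h ?u)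
          + tderiv A p (coord_vec A c z p) \<phi> * (?h ?u \<circ> chart_inv c) ?x))) (at ?x)"
    proof (rule has_derivative_transform_within_open)
      show "((\<lambda>z. 2 * ((\<phi> \<circ> chart_inv c) z * (?h ?u \<circ> chart_inv c) z)) has_derivative
        (\<lambda>z. 2 * ((\<phi> \<circ> chart_inv c) ?x * tderiv A p (coord_vec A c z p) (?h ?u)
          + tderiv A p (coord_vec A c z p) \<phi> * (?h ?u \<circ> chart_inv c) ?x))) (at ?x)"
        by (intro has_derivative_mult_right has_derivative_mult D\<phi> Dh)
      show "open ?S" by (rule op)
      show "2 * ((\<phi> \<circ> chart_inv c) z * (?h ?u \<circ> chart_inv c) z) = frechet_derivative ?F (at z) ?u"
        if "z \<in> ?S" for z
        using that dF c(1) by auto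
    qed (use c in simp)
    have "tderiv A p y (?h ?u) = \<phi> p * g p y x + g p (V p) (D p y (coord_vec A c ?u))"
      using metric_compat_coord[OF open_UNIV V UNIV_I y c, of ?u] x y c
      by (simp add: D_V g_scale_left)
    then show ?thesis
      using has_derivative_imp_frechet[OF D2] c x y by (simp add: algebra_simps)
  qed
  have "D p v (coord_vec A c (w c)) = D p w (coord_vec A c (v c))"
    using D_coord_vec_sym[OF c, of "v c" "w c"] c v w by simp
  moreover have "frechet_derivative (\<lambda>z. frechet_derivative ?F (at z) (v c)) (at ?x) (w c)
    = frechet_derivative (\<lambda>z. frechet_derivative ?F (at z) (w c)) (at ?x) (v c)"
    using c by (intro symmetric_second_derivative[OF op _ smF]) simp
  ultimately show ?thesis
    using second[OF v w] second[OF w v] g_sym[OF v w] by simp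
qed

lemma dphi_times_V_nonneg:
  assumes v: "v \<in> tangent_space A p" and "g p (gradient A g \<phi> p) (V p) \<ge> 0"
  shows "tderiv A p v \<phi> * g p (V p) v \<ge> 0"
proof (cases "V p = 0")
  case True
  obtain c where "c \<in> A" "p \<in> fst c" by (rule ex_chart)
  then show ?thesis using True v g_zero_left by simp
next
  case False
  have "tderiv A p (V p) \<phi> \<ge> 0"
    using assms(2) gradient_works(2)[OF \<phi> UNIV_I V_tangent] by simp
  then have "tderiv A p (V p) \<phi> * (g p (V p) v)\<^sup>2 \<ge> 0" by simp
  \<comment> \<open>This is \<open>dphi_wedge_V\<close> with \<open>w = V p\<close>, multiplied by
    \<open>g p (V p) v\<close>. The factor \<open>g p (V p) (V p)\<close> is positive in this case
    and can be divided out.\<close>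
  also have "tderiv A p (V p) \<phi> * (g p (V p) v)\<^sup>2 = (tderiv A p v \<phi> * g p (V p) v) * g p (V p) (V p)"
    using dphi_wedge_V[OF v V_tangent] by (simp add: power2_eq_square algebra_simps)
  finally show ?thesis
    using g_pos[OF V_tangent V_tangent False] by (simp add: zero_le_mult_iff)
qed

end

locale conformal_geodesic =
  closed_conformal_field A g D V \<phi> + geodesic_segment A g D a b \<gamma>
  for A :: "('m::{t2_space,second_countable_topology}, 'e::euclidean_space) chart set"
    and g D V \<phi> a b \<gamma>
begin

section \<open>The energy along a geodesic\<close>

lemma has_real_derivative_energy:
  assumes "t \<in> {a..b}"
  shows "((\<lambda>s. energy g V (\<gamma> s)) has_real_derivative \<phi> (\<gamma> t) * g (\<gamma> t) (V (\<gamma> t)) (vel t))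
    (at t within {a..b})"
  using DERIV_cmult[OF has_real_derivative_along[OF assms smooth_fun_norm2 UNIV_I], of "1/2"] assms
  by (simp add: energy_def tderiv_norm2)

lemma has_real_derivative_energy':
  assumes "t \<in> {a..b}"
  shows "((\<lambda>s. \<phi> (\<gamma> s) * g (\<gamma> s) (V (\<gamma> s)) (vel s)) has_real_derivative
    tderiv A (\<gamma> t) (vel t) \<phi> * g (\<gamma> t) (V (\<gamma> t)) (vel t) + (\<phi> (\<gamma> t))\<^sup>2 * g (\<gamma> t) (vel t) (vel t))
    (at t within {a..b})"
  using DERIV_mult[OF has_real_derivative_along[OF assms \<phi> UNIV_I]
      has_real_derivative_g_vel[OF open_UNIV V assms UNIV_I]] assms
  by (simp add: D_V g_scale_left power2_eq_square algebra_simps)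

lemma energy_chord:
  assumes "0 < t" "t < 1"
  obtains K \<zeta> where "K > 0" "\<zeta> \<in> {a..b}"
    "(1 - t) * energy g V (\<gamma> a) + t * energy g V (\<gamma> b) - energy g V (\<gamma> ((1 - t) * a + t * b))
      = K * (tderiv A (\<gamma> \<zeta>) (vel \<zeta>) \<phi> * g (\<gamma> \<zeta>) (V (\<gamma> \<zeta>)) (vel \<zeta>)
        + (\<phi> (\<gamma> \<zeta>))\<^sup>2 * g (\<gamma> \<zeta>) (vel \<zeta>) (vel \<zeta>))"
  by (rule second_order_chord[OF ab assms has_real_derivative_energy has_real_derivative_energy'])
    (assumption | rule that)+

lemma speed_nonneg:
  assumes "t \<in> {a..b}"
  shows "g (\<gamma> t) (vel t) (vel t) \<ge> 0"
proof -
  obtain c where "c \<in> A" "\<gamma> t \<in> fst c" by (rule ex_chart)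
  then show ?thesis
    using g_pos[OF vel_tangent[OF assms] vel_tangent[OF assms]] g_zero_left vel_tangent[OF assms]
    by (cases "vel t = 0") auto
qed

end

theorem theorem2:
  fixes A :: "('m::{t2_space,second_countable_topology}, 'e::euclidean_space) chart set"
    and g :: "('m, 'e) metric"
    and D :: "('m, 'e) conn"
    and V :: "'m \<Rightarrow> ('m, 'e) tvec"
    and \<phi> :: "'m \<Rightarrow> real"
  assumes "riemannian_manifold A g"
    and "levi_civita A g D"
    and "complete_manifold A D"
    and "\<not> compact (UNIV :: 'm set)"
    and "smooth_field A UNIV V"
    and "smooth_fun A UNIV \<phi>"
    and "closed_conformal A D V \<phi>"
    and "\<And>p. g p (gradient A g \<phi> p) (V p) \<ge> 0"
  shows "geod_convex A D (energy g V) \<and>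
    ((\<forall>p. V p \<noteq> 0 \<and> \<phi> p \<noteq> 0) \<longrightarrow> geod_strictly_convex A D (energy g V))"
proof -
  interpret closed_conformal_field A g D V \<phi>
    using assms by unfold_locales (auto simp: riemannian_manifold_def)
  let ?f = "energy g V"
  have convex: "?f (\<gamma> ((1 - t) * a + t * b)) \<le> (1 - t) * ?f (\<gamma> a) + t * ?f (\<gamma> b)"
    if "a \<le> b" "geodesic_on A D {a..b} \<gamma>" "t \<in> {0..1}" for a b \<gamma> t
  \<comment> \<open>Equality holds in the degenerate cases; \<open>energy_chord\<close> covers
    nondegenerate segments and interior \<open>t\<close>.\<close>
  proof (cases "a = b \<or> t = 0 \<or> t = 1")
    case True
    then show ?thesis by (auto simp: algebra_simps)
  next
    case False
    then have t: "0 < t" "t < 1" and "a < b" using that by auto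
    interpret conformal_geodesic A g D V \<phi> a b \<gamma>
      using that \<open>a < b\<close> by unfold_locales
    obtain K \<zeta> where K: "K > 0" "\<zeta> \<in> {a..b}"
      "(1 - t) * ?f (\<gamma> a) + t * ?f (\<gamma> b) - ?f (\<gamma> ((1 - t) * a + t * b))
        = K * (tderiv A (\<gamma> \<zeta>) (vel \<zeta>) \<phi> * g (\<gamma> \<zeta>) (V (\<gamma> \<zeta>)) (vel \<zeta>)
          + (\<phi> (\<gamma> \<zeta>))\<^sup>2 * g (\<gamma> \<zeta>) (vel \<zeta>) (vel \<zeta>))"
      by (rule energy_chord[OF t])
    have "tderiv A (\<gamma> \<zeta>) (vel \<zeta>) \<phi> * g (\<gamma> \<zeta>) (V (\<gamma> \<zeta>)) (vel \<zeta>)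
          + (\<phi> (\<gamma> \<zeta>))\<^sup>2 * g (\<gamma> \<zeta>) (vel \<zeta>) (vel \<zeta>) \<ge> 0"
      using dphi_times_V_nonneg[OF vel_tangent[OF K(2)] assms(8)] speed_nonneg[OF K(2)] by simp
    then have "K * (tderiv A (\<gamma> \<zeta>) (vel \<zeta>) \<phi> * g (\<gamma> \<zeta>) (V (\<gamma> \<zeta>)) (vel \<zeta>)
          + (\<phi> (\<gamma> \<zeta>))\<^sup>2 * g (\<gamma> \<zeta>) (vel \<zeta>) (vel \<zeta>)) \<ge> 0"
      using K(1) by simp
    then show ?thesis using K(3) by linarith
  qed
  have strict: "?f (\<gamma> ((1 - t) * a + t * b)) < (1 - t) * ?f (\<gamma> a) + t * ?f (\<gamma> b)"
    if "a < b" "geodesic_on A D {a..b} \<gamma>" "\<not> \<gamma> constant_on {a..b}" "t \<in> {0<..<1}" "\<And>p. \<phi> p \<noteq> 0"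
    for a b \<gamma> t
  proof -
    have t: "0 < t" "t < 1" using that by auto
    interpret conformal_geodesic A g D V \<phi> a b \<gamma>
      using that by unfold_locales
    obtain K \<zeta> where K: "K > 0" "\<zeta> \<in> {a..b}"
      "(1 - t) * ?f (\<gamma> a) + t * ?f (\<gamma> b) - ?f (\<gamma> ((1 - t) * a + t * b))
        = K * (tderiv A (\<gamma> \<zeta>) (vel \<zeta>) \<phi> * g (\<gamma> \<zeta>) (V (\<gamma> \<zeta>)) (vel \<zeta>)
          + (\<phi> (\<gamma> \<zeta>))\<^sup>2 * g (\<gamma> \<zeta>) (vel \<zeta>) (vel \<zeta>))"
      by (rule energy_chord[OF t])
    \<comment> \<open>The mean value point is not under control, so the velocity has to be nonzero
      at every time; a zero anywhere would make the geodesic constant.\<close>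
    have "vel \<zeta> \<noteq> 0" using constant_if_vel_zero K(2) that(3) by blast
    then have "(\<phi> (\<gamma> \<zeta>))\<^sup>2 * g (\<gamma> \<zeta>) (vel \<zeta>) (vel \<zeta>) > 0"
      using g_pos[OF vel_tangent[OF K(2)] vel_tangent[OF K(2)]] that(5) by simp
    then have "tderiv A (\<gamma> \<zeta>) (vel \<zeta>) \<phi> * g (\<gamma> \<zeta>) (V (\<gamma> \<zeta>)) (vel \<zeta>)
          + (\<phi> (\<gamma> \<zeta>))\<^sup>2 * g (\<gamma> \<zeta>) (vel \<zeta>) (vel \<zeta>) > 0"
      using dphi_times_V_nonneg[OF vel_tangent[OF K(2)] assms(8)] by linarith
    then have "K * (tderiv A (\<gamma> \<zeta>) (vel \<zeta>) \<phi> * g (\<gamma> \<zeta>) (V (\<gamma> \<zeta>)) (vel \<zeta>)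
          + (\<phi> (\<gamma> \<zeta>))\<^sup>2 * g (\<gamma> \<zeta>) (vel \<zeta>) (vel \<zeta>)) > 0"
      using K(1) by simp
    then show ?thesis using K(3) by linarith
  qed
  show ?thesis
    unfolding geod_convex_def geod_strictly_convex_def using convex strict by simp
qed

end
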